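(* Let $(X_n,M_n)_{n\ge0}$ be the $\{-1,1\}\times\mathbb{N}^*$-valued Markov chain described in the context, with $(X_0,M_0)=(1,1)$, and let $S_n=\sum_{k=0}^nX_k$. Assume $\Theta_1<\infty$ and $\Theta_2<\infty$. (i) $S_n/n$ converges almost surely and in $L^1$ to $\dfrac{\Theta_2-\Theta_1}{\Theta_1+\Theta_2}$ as $n\to\infty$. (ii) If moreover $\sum_{k\ge1}k\,\mathcal{P}_i(k)<\infty$ for $i=1,2$, then $$\frac{1}{\sqrt{n\Upsilon}}\left(S_n-n\,\frac{\Theta_2-\Theta_1}{\Theta_1+\Theta_2}\right)$$ converges in distribution to a standard Gaussian random variable as $n\to\infty$, where $$\Upsilon=\frac{4}{\Theta_1+\Theta_2}\ \mathbb{E}\left[\left(T_1-\frac{\Theta_2T_2}{\Theta_1+\Theta_2}\right)^2\right].$$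
   Context: $\mathbb{N}^*=\{1,2,\ldots\}$; $a_1=-1$, $a_2=1$; $\alpha_{i,n}\in(0,1)$ for $i=1,2$, $n\ge1$. The chain $(X_n,M_n)$ goes from $(a_i,n)$ to $(a_i,n+1)$ with probability $1-\alpha_{i,n}$ and to $(a_j,1)$, $j\ne i$, with probability $\alpha_{i,n}$. $\mathcal{P}_i(m)=\prod_{k=1}^{m-1}(1-\alpha_{i,k})$ for $m\ge1$ (empty product $=1$), $\Theta_i=\sum_{n\ge1}\mathcal{P}_i(n)$. The change times are $T_0=0$ and $T_n=\inf\{i\ge T_{n-1}:X_i\ne X_{T_{n-1}}\}$, $n\ge1$. *)

theory Defs
  imports "HOL-Probability.Probability"
begin

text \<open>Transition probabilities enter through their conditional form; histories of probability
  zero are exempt. The initial law is not part of the definition.\<close>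

definition markov_chain ::
  "'w measure \<Rightarrow> 's set \<Rightarrow> ('s \<Rightarrow> 's \<Rightarrow> real) \<Rightarrow> (nat \<Rightarrow> 'w \<Rightarrow> 's) \<Rightarrow> bool" where
  "markov_chain P E p Z \<longleftrightarrow>
     prob_space P \<and> countable E \<and>
     (\<forall>n. Z n \<in> measurable P (count_space E)) \<and>
     (\<forall>n s t. (\<forall>k\<le>n. s k \<in> E) \<longrightarrow> t \<in> E \<longrightarrow>
        \<P>(\<omega> in P. \<forall>k\<le>n. Z k \<omega> = s k) > 0 \<longrightarrow>
        \<P>(\<omega> in P. Z (Suc n) \<omega> = t \<bar> \<forall>k\<le>n. Z k \<omega> = s k) = p (s n) t)"

definition a :: "nat \<Rightarrow> real" where
  "a i = (if i = 1 then - 1 else 1)"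

definition states :: "(real \<times> nat) set" where
  "states = {a 1, a 2} \<times> {1..}"

definition idx :: "real \<Rightarrow> nat" where
  "idx x = (if x = a 1 then 1 else 2)"

text \<open>The parameter \<open>\<alpha> i n\<close> is only meaningful for \<open>i \<in> {1, 2}\<close> and \<open>n \<ge> 1\<close>.\<close>

definition trans_prob :: "(nat \<Rightarrow> nat \<Rightarrow> real) \<Rightarrow> real \<times> nat \<Rightarrow> real \<times> nat \<Rightarrow> real" where
  "trans_prob \<alpha> = (\<lambda>(x, n) (y, m).
     if y = x \<and> m = n + 1 then 1 - \<alpha> (idx x) n
     else if y \<noteq> x \<and> m = 1 then \<alpha> (idx x) n
     else 0)"

definition surv :: "(nat \<Rightarrow> nat \<Rightarrow> real) \<Rightarrow> nat \<Rightarrow> nat \<Rightarrow> real" where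
  "surv \<alpha> i m = (\<Prod>k\<in>{1..<m}. 1 - \<alpha> i k)"

definition Theta :: "(nat \<Rightarrow> nat \<Rightarrow> real) \<Rightarrow> nat \<Rightarrow> real" where
  "Theta \<alpha> i = (\<Sum>n. surv \<alpha> i (Suc n))"

definition psum :: "(nat \<Rightarrow> 'w \<Rightarrow> real) \<Rightarrow> nat \<Rightarrow> 'w \<Rightarrow> real" where
  "psum X n \<omega> = (\<Sum>k\<le>n. X k \<omega>)"

text \<open>If \<open>T\<^sub>n = \<infinity>\<close>, the set below is empty, so that \<open>T\<^sub>n\<^sub>+\<^sub>1 = \<infinity>\<close> as well.\<close>

primrec change_time :: "(nat \<Rightarrow> 'w \<Rightarrow> real) \<Rightarrow> nat \<Rightarrow> 'w \<Rightarrow> enat" where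
  "change_time X 0 \<omega> = 0"
| "change_time X (Suc n) \<omega> =
     Inf {enat i | i. change_time X n \<omega> \<le> enat i \<and>
                      X i \<omega> \<noteq> X (the_enat (change_time X n \<omega>)) \<omega>}"

text \<open>When both \<open>\<Theta>\<^sub>i\<close> are finite, the change times are almost surely finite, so the value of
  \<open>the_enat\<close> at infinity does not affect the expectation.\<close>

definition Upsilon ::
  "(nat \<Rightarrow> nat \<Rightarrow> real) \<Rightarrow> 'w measure \<Rightarrow> (nat \<Rightarrow> 'w \<Rightarrow> real) \<Rightarrow> real" where
  "Upsilon \<alpha> P X =
     4 / (Theta \<alpha> 1 + Theta \<alpha> 2) *
     (LINT \<omega>|P. (real (the_enat (change_time X 1 \<omega>))
        - Theta \<alpha> 2 * real (the_enat (change_time X 2 \<omega>)) / (Theta \<alpha> 1 + Theta \<alpha> 2))\<^sup>2)"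

end

theory Submission
  imports Defs
begin

text \<open>
  A trajectory is a succession of cycles, each a stretch in state \<open>1\<close> followed by a stretch in state
  \<open>- 1\<close>. At the beginning of each stretch the age component is back at \<open>1\<close>, so the Markov property makes
  the lengths of all stretches independent: the probability of a finite path is a product of
  transition probabilities, and these group into one factor per stretch
  (\<open>path_prob\<close>). A stretch in the state with index \<open>i\<close> exceeds \<open>t\<close> with probability
  \<open>surv \<alpha> i (Suc t)\<close>; its mean is \<open>Theta \<alpha> i\<close>, and it has a second moment under the hypothesis of the
  central limit theorem. The partial sums are thus those of a renewal reward process whose cycles
  have mean length \<open>Theta \<alpha> 1 + Theta \<alpha> 2\<close> and mean gain \<open>Theta \<alpha> 2 - Theta \<alpha> 1\<close>
  (\<open>trajectory\<close>, \<open>Y_indep\<close>, \<open>Y_law\<close>, \<open>occupation_close\<close>).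

  For the law of large numbers, both the gain of the first \<open>k\<close> cycles and their total length grow
  linearly in \<open>k\<close>, and the quotient of the two rates is the limit (\<open>renewal_reward_law\<close>). This rests on
  the strong law for integrable independent variables, proved here by a maximal argument together with
  the zero-one law (\<open>strong_law_of_large_numbers\<close>). The averages are bounded by \<open>2\<close>, so convergence in
  mean follows by domination.

  For the central limit theorem, the gain of a cycle is centred by its length times the limiting rate.
  The centred variables obey the classical theorem along a deterministic number of cycles
  \<open>r n \<approx> n / (Theta \<alpha> 1 + Theta \<alpha> 2)\<close>. The number of cycles completed by time \<open>n\<close> is random, but the cycle
  in progress at time \<open>n\<close> has a stopping time as its index. The sums up to that index and up to \<open>r n\<close>
  differ by a predictable transform of centred independent variables, whose second moment is the
  variance of a single cycle times the mean number of cycles between the two (\<open>stopped_V_second_moment\<close>). By the law of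
  large numbers that number is \<open>o(n)\<close>, so the difference vanishes after normalization, and so does the
  contribution of the cycle in progress (\<open>renewal_reward_clt\<close>). The constant \<open>Upsilon\<close> is the variance of
  the centred gain of the first cycle per mean cycle length, because \<open>T\<^sub>1\<close> and \<open>T\<^sub>2\<close> are the first
  sojourn length and the first cycle length (\<open>Upsilon_eq\<close>).
\<close>

section \<open>The strong law of large numbers\<close>

text \<open>The empty sum counts among the partial sums, so that the running maximum starts at \<open>0\<close>.\<close>

primrec pmax :: "(nat \<Rightarrow> real) \<Rightarrow> nat \<Rightarrow> real" where
  "pmax f 0 = 0"
| "pmax f (Suc n) = max (pmax f n) (\<Sum>i<Suc n. f i)"

text \<open>Splitting off the first summand instead of the last: this is the identity by which the maximum
  over \<open>n + 1\<close> steps is compared with an equally distributed copy of the maximum over \<open>n\<close> steps.\<close>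

lemma pmax_Suc_shift: "pmax f (Suc n) = max 0 (f 0 + pmax (\<lambda>i. f (Suc i)) n)"
proof (induction n)
  case 0
  then show ?case by simp
next
  case (Suc n)
  have "pmax f (Suc (Suc n)) = max (pmax f (Suc n)) (\<Sum>i<Suc (Suc n). f i)"
    by (rule pmax.simps)
  also have "\<dots> = max (max 0 (f 0 + pmax (\<lambda>i. f (Suc i)) n)) (f 0 + (\<Sum>i<Suc n. f (Suc i)))"
    by (simp only: Suc.IH sum.lessThan_Suc_shift)
  finally show ?case
    by (simp add: max_def)
qed

lemma pmax_mono: "m \<le> n \<Longrightarrow> pmax f m \<le> pmax f n"
  by (rule lift_Suc_mono_le[of "pmax f"]) auto

lemma pmax_nonneg: "0 \<le> pmax f n"
  using pmax_mono[of 0 n f] by simp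

lemma sum_le_pmax: "(\<Sum>i<n. f i) \<le> pmax f n"
  by (cases n) auto

lemma pmax_restrict: "n \<le> N \<Longrightarrow> pmax (restrict f {..<N}) n = pmax f n"
  by (induction n) auto

lemma pmax_measurable:
  "n \<le> N \<Longrightarrow> (\<lambda>f. pmax f n) \<in> borel_measurable (\<Pi>\<^sub>M i\<in>{..<N}. borel)"
proof (induction n)
  case (Suc n)
  then have [measurable]: "(\<lambda>f. pmax f n) \<in> borel_measurable (\<Pi>\<^sub>M i\<in>{..<N}. borel)"
    by simp
  have [measurable]: "(\<lambda>f :: nat \<Rightarrow> real. f i) \<in> borel_measurable (\<Pi>\<^sub>M i\<in>{..<N}. borel)" if "i < Suc n" for i
    using Suc.prems that by (intro measurable_component_singleton) auto
  have "(\<lambda>f :: nat \<Rightarrow> real. \<Sum>i<Suc n. f i) \<in> borel_measurable (\<Pi>\<^sub>M i\<in>{..<N}. borel)"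
    by (intro borel_measurable_sum) auto
  then show ?case by simp
qed simp

lemma (in prob_space) indep_vars_shift:
  assumes ind: "indep_vars (\<lambda>_. N) X (UNIV :: nat set)"
  shows "indep_vars (\<lambda>_. N) (\<lambda>i. X (Suc i)) UNIV"
proof -
  have "indep_vars (\<lambda>j. PiM {Suc j} (\<lambda>_. N)) (\<lambda>j \<omega>. restrict (\<lambda>i. X i \<omega>) {Suc j}) UNIV"
    by (rule indep_vars_restrict[OF ind]) (auto simp: disjoint_family_on_def)
  then have "indep_vars (\<lambda>_. N) (\<lambda>j \<omega>. (\<lambda>f. f (Suc j)) (restrict (\<lambda>i. X i \<omega>) {Suc j})) UNIV"
    by (rule indep_vars_compose2) (auto intro: measurable_component_singleton)
  then show ?thesis by simp
qed

lemma (in prob_space) identically_distributed_shift: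
  fixes X :: "nat \<Rightarrow> 'a \<Rightarrow> real"
  assumes ind: "indep_vars (\<lambda>_. borel) X UNIV"
    and id: "\<And>i. distr M borel (X i) = distr M borel (X 0)"
  shows "distr M (\<Pi>\<^sub>M i\<in>{..<n}. borel) (\<lambda>\<omega>. \<lambda>i\<in>{..<n}. X i \<omega>)
       = distr M (\<Pi>\<^sub>M i\<in>{..<n}. borel) (\<lambda>\<omega>. \<lambda>i\<in>{..<n}. X (Suc i) \<omega>)"
proof (cases "n = 0")
  case True
  then show ?thesis by (simp add: restrict_def)
next
  case False
  have rv: "random_variable borel (X i)" for i
    using ind by (auto simp: indep_vars_def)
  have 1: "indep_vars (\<lambda>_. borel) X {..<n}"
    using ind by (rule indep_vars_subset) auto
  have "indep_vars (\<lambda>_. borel) (\<lambda>i. X (Suc i)) UNIV"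
    by (rule indep_vars_shift[OF ind])
  then have 2: "indep_vars (\<lambda>_. borel) (\<lambda>i. X (Suc i)) {..<n}"
    by (rule indep_vars_subset) auto
  have "distr M (\<Pi>\<^sub>M i\<in>{..<n}. borel) (\<lambda>\<omega>. \<lambda>i\<in>{..<n}. X i \<omega>)
      = (\<Pi>\<^sub>M i\<in>{..<n}. distr M borel (X i))"
    using 1 indep_vars_iff_distr_eq_PiM[where I="{..<n}" and M'="\<lambda>_. borel" and X=X] rv False by auto
  also have "\<dots> = (\<Pi>\<^sub>M i\<in>{..<n}. distr M borel (X (Suc i)))"
    by (intro PiM_cong refl) (metis id)
  also have "\<dots> = distr M (\<Pi>\<^sub>M i\<in>{..<n}. borel) (\<lambda>\<omega>. \<lambda>i\<in>{..<n}. X (Suc i) \<omega>)"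
    using 2 indep_vars_iff_distr_eq_PiM[where I="{..<n}" and M'="\<lambda>_. borel" and X="\<lambda>i. X (Suc i)"]
      rv False by (simp add: lessThan_empty_iff)
  finally show ?thesis .
qed

text \<open>Dropping the first \<open>m\<close> summands moves all partial sums by a bounded amount. Unboundedness from
  above is therefore decided by the summands from \<open>m\<close> on, for every \<open>m\<close>, and the zero-one law applies.\<close>

lemma (in prob_space) sum_unbounded_0_1:
  fixes X :: "nat \<Rightarrow> 'a \<Rightarrow> real"
  assumes ind: "indep_vars (\<lambda>_. borel) X UNIV"
  defines "A \<equiv> {\<omega> \<in> space M. \<forall>C::nat. \<exists>n. real C < (\<Sum>i<n. X i \<omega>)}"
  shows "prob A = 0 \<or> prob A = 1"
proof -
  let ?F = "\<lambda>i. {X i -` B \<inter> space M | B. B \<in> sets borel}"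
  have rv[measurable]: "random_variable borel (X i)" for i
    using ind by (auto simp: indep_vars_def)
  have ind': "indep_sets ?F UNIV"
    using ind by (auto simp: indep_vars_def2)
  have sa: "sigma_algebra (space M) (?F i)" for i
    using sets.sigma_algebra_axioms[of "vimage_algebra (space M) (X i) borel"]
    by (simp add: sets_vimage_algebra2)
  have "A \<in> tail_events ?F"
    unfolding tail_events_def
  proof
    fix m :: nat
    \<comment> \<open>the information in the variables from \<open>m\<close> on\<close>
    define N where "N = sigma (space M) (\<Union>i\<in>{m..}. ?F i)"
    have sub: "(\<Union>i\<in>{m..}. ?F i) \<subseteq> Pow (space M)" by auto
    have spN: "space N = space M" and setsN: "sets N = sigma_sets (space M) (\<Union>i\<in>{m..}. ?F i)"
      using sub by (auto simp: N_def)
    have XN[measurable]: "X (i + m) \<in> borel_measurable N" for i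
    proof (rule measurableI)
      fix B :: "real set" assume "B \<in> sets borel"
      then have "X (i + m) -` B \<inter> space M \<in> (\<Union>i\<in>{m..}. ?F i)" by force
      then show "X (i + m) -` B \<inter> space N \<in> sets N"
        unfolding setsN spN by (rule sigma_sets.Basic)
    qed auto
    have "A = {\<omega> \<in> space N. \<forall>C::nat. \<exists>n. real C < (\<Sum>i<n. X (i + m) \<omega>)}"
    proof -
      have "(\<forall>C::nat. \<exists>n. real C < (\<Sum>i<n. f i)) \<longleftrightarrow> (\<forall>C::nat. \<exists>n. real C < (\<Sum>i<n. f (i + m)))"
        (is "?L \<longleftrightarrow> ?R") for f :: "nat \<Rightarrow> real"
      proof
        have split: "(\<Sum>i<n + m. f i) = (\<Sum>i<m. f i) + (\<Sum>i<n. f (i + m))" for n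
          by (induction n) auto
        {
          assume L: ?L
          show ?R
          proof
            fix C :: nat
            define K where "K = (\<Sum>i<m. \<bar>f i\<bar>)"
            obtain C' :: nat where C': "real C + K < real C'" using reals_Archimedean2 by blast
            obtain n where n: "real C' < (\<Sum>i<n. f i)" using L by blast
            have small: "(\<Sum>i<n. f i) \<le> K" if "n \<le> m" for n
            proof -
              have "(\<Sum>i<n. f i) \<le> (\<Sum>i<n. \<bar>f i\<bar>)" by (rule sum_mono) auto
              also have "\<dots> \<le> K" unfolding K_def using that by (intro sum_mono2) auto
              finally show ?thesis .
            qed
            have "\<not> n \<le> m" using small[of n] n C' by auto
            then obtain l where l: "n = l + m" by (metis add.commute le_add_diff_inverse nat_le_linear)
            have "(\<Sum>i<n. f i) \<le> K + (\<Sum>i<l. f (i + m))" using split[of l] small[of m] l by simp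
            then show "\<exists>n. real C < (\<Sum>i<n. f (i + m))" using n C' by (intro exI[of _ l]) linarith
          qed
        }
        {
          assume R: ?R
          show ?L
          proof
            fix C :: nat
            obtain C' :: nat where C': "real C - (\<Sum>i<m. f i) < real C'" using reals_Archimedean2 by blast
            obtain n where n: "real C' < (\<Sum>i<n. f (i + m))" using R by blast
            then show "\<exists>n. real C < (\<Sum>i<n. f i)" using split[of n] C' by (intro exI[of _ "n + m"]) linarith
          qed
        }
      qed
      note this[of "\<lambda>i. X i _"]
      then show ?thesis unfolding A_def spN by blast
    qed
    also have "\<dots> \<in> sets N" by measurable
    finally show "A \<in> sigma_sets (space M) (\<Union> (?F ` {m..}))" by (simp add: setsN)
  qed
  then show ?thesis
    by (rule kolmogorov_0_1_law[OF sa ind'])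
qed

text \<open>Let \<open>M\<^sub>n\<close> be the maximum of the first \<open>n\<close> partial sums and \<open>M'\<^sub>n\<close> the same maximum for the shifted
  sequence. Both have the same law, and \<open>M\<^sub>n\<^sub>+\<^sub>1 = max 0 (X\<^sub>0 + M'\<^sub>n) \<ge> M\<^sub>n\<close>, so
  \<open>M\<^sub>n\<^sub>+\<^sub>1 - M'\<^sub>n = max (- M'\<^sub>n) X\<^sub>0\<close> has nonnegative expectation. If the sums were almost surely
  unbounded, this variable would tend to \<open>X\<^sub>0\<close> under the bound \<open>\<bar>X\<^sub>0\<bar>\<close>, forcing
  \<open>expectation X\<^sub>0 \<ge> 0\<close>. By the zero-one law the sums are then almost surely bounded above.\<close>

lemma (in prob_space) negative_mean_sums_bounded:
  fixes X :: "nat \<Rightarrow> 'a \<Rightarrow> real"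
  assumes ind: "indep_vars (\<lambda>_. borel) X UNIV"
    and id: "\<And>i. distr M borel (X i) = distr M borel (X 0)"
    and int: "integrable M (X 0)"
    and neg: "expectation (X 0) < 0"
  shows "AE \<omega> in M. \<exists>C. \<forall>n. (\<Sum>i<n. X i \<omega>) \<le> C"
proof -
  have rv[measurable]: "random_variable borel (X i)" for i
    using ind by (auto simp: indep_vars_def)
  have int_X: "integrable M (X i)" for i
  proof -
    have "integrable (distr M borel (X i)) (\<lambda>x. x)"
      unfolding id[of i] using int by (simp add: integrable_distr_eq)
    then show ?thesis by (simp add: integrable_distr_eq)
  qed
  let ?M = "\<lambda>n \<omega>. pmax (\<lambda>i. X i \<omega>) n" and ?M' = "\<lambda>n \<omega>. pmax (\<lambda>i. X (Suc i) \<omega>) n"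
  have int_pmax: "integrable M (\<lambda>\<omega>. pmax (\<lambda>i. X (k + i) \<omega>) n)" for k n :: nat
    by (induction n) (auto intro!: integrable_max int_X Bochner_Integration.integrable_sum Bochner_Integration.integrable_add)
  have int_M: "integrable M (?M n)" and int_M': "integrable M (?M' n)" for n
    using int_pmax[of 0 n] int_pmax[of 1 n] by simp_all
  note [measurable] = borel_measurable_integrable[OF int_M] borel_measurable_integrable[OF int_M']
  have same: "expectation (?M n) = expectation (?M' n)" for n
  proof -
    have vec[measurable]: "(\<lambda>\<omega>. \<lambda>i\<in>{..<n}. X (g i) \<omega>) \<in> measurable M (\<Pi>\<^sub>M i\<in>{..<n}. borel)" for g
      by (rule measurable_restrict) simp
    have "expectation (?M n) = (\<integral>\<omega>. pmax (\<lambda>i\<in>{..<n}. X i \<omega>) n \<partial>M)"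
      by (simp add: pmax_restrict)
    also have "\<dots> = (\<integral>f. pmax f n \<partial>distr M (\<Pi>\<^sub>M i\<in>{..<n}. borel) (\<lambda>\<omega>. \<lambda>i\<in>{..<n}. X i \<omega>))"
      using vec[of "\<lambda>i. i"] by (subst integral_distr) (auto intro: pmax_measurable)
    also have "\<dots> = (\<integral>\<omega>. pmax (\<lambda>i\<in>{..<n}. X (Suc i) \<omega>) n \<partial>M)"
      unfolding identically_distributed_shift[OF ind id]
      using vec[of Suc] by (subst integral_distr) (auto intro: pmax_measurable)
    finally show ?thesis by (simp add: pmax_restrict)
  qed
  have nonneg: "0 \<le> expectation (\<lambda>\<omega>. max (- ?M' n \<omega>) (X 0 \<omega>))" for n
  proof -
    have "expectation (?M' n) = expectation (?M n)" by (simp add: same)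
    also have "\<dots> \<le> expectation (?M (Suc n))"
      by (intro integral_mono int_M) (auto intro: pmax_mono simp del: pmax.simps)
    finally have "0 \<le> expectation (?M (Suc n)) - expectation (?M' n)" by simp
    also have "\<dots> = expectation (\<lambda>\<omega>. ?M (Suc n) \<omega> - ?M' n \<omega>)"
      by (rule Bochner_Integration.integral_diff[symmetric]) (rule int_M int_M')+
    also have "\<dots> = expectation (\<lambda>\<omega>. max (- ?M' n \<omega>) (X 0 \<omega>))"
      unfolding pmax_Suc_shift by (intro Bochner_Integration.integral_cong refl) linarith
    finally show ?thesis .
  qed
  define A where "A = {\<omega> \<in> space M. \<forall>C::nat. \<exists>n. real C < (\<Sum>i<n. X i \<omega>)}"
  have A[measurable]: "A \<in> events" unfolding A_def by measurable
  have "prob A \<noteq> 1"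
  proof
    assume "prob A = 1"
    then have ae: "AE \<omega> in M. \<forall>C::nat. \<exists>n. real C < (\<Sum>i<n. X i \<omega>)"
      using prob_eq_1[OF A] by (auto simp: A_def elim: AE_mp)
    have "(\<lambda>n. expectation (\<lambda>\<omega>. max (- ?M' n \<omega>) (X 0 \<omega>))) \<longlonglongrightarrow> expectation (X 0)"
    proof (rule integral_dominated_convergence[where w = "\<lambda>\<omega>. \<bar>X 0 \<omega>\<bar>"])
      show "AE \<omega> in M. (\<lambda>n. max (- ?M' n \<omega>) (X 0 \<omega>)) \<longlonglongrightarrow> X 0 \<omega>"
        using ae
      proof eventually_elim
        case (elim \<omega>)
        obtain C :: nat where C: "\<bar>X 0 \<omega>\<bar> < real C" using reals_Archimedean2 by blast
        obtain n where n: "real (2 * C) < (\<Sum>i<n. X i \<omega>)" using elim by blast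
        have "max (- ?M' m \<omega>) (X 0 \<omega>) = X 0 \<omega>" if "m \<ge> n" for m
        proof -
          have "real (2 * C) < pmax (\<lambda>i. X i \<omega>) (Suc m)"
            using n sum_le_pmax[of "\<lambda>i. X i \<omega>" n] pmax_mono[of n "Suc m" "\<lambda>i. X i \<omega>"] that by linarith
          then have "real (2 * C) < max 0 (X 0 \<omega> + ?M' m \<omega>)"
            by (simp only: pmax_Suc_shift)
          then show ?thesis using C by (auto simp: max_def split: if_splits)
        qed
        then show ?case
          by (intro tendsto_eventually eventually_sequentiallyI[of n]) auto
      qed
      show "AE \<omega> in M. norm (max (- ?M' n \<omega>) (X 0 \<omega>)) \<le> \<bar>X 0 \<omega>\<bar>" for n
      proof (rule AE_I2)
        fix \<omega>
        show "norm (max (- ?M' n \<omega>) (X 0 \<omega>)) \<le> \<bar>X 0 \<omega>\<bar>"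
          using pmax_nonneg[of "\<lambda>i. X (Suc i) \<omega>" n] unfolding real_norm_def by linarith
      qed
    qed (auto intro: int integrable_abs)
    then have "0 \<le> expectation (X 0)"
      by (rule LIMSEQ_le_const) (use nonneg in auto)
    with neg show False by simp
  qed
  then have "prob A = 0"
    using sum_unbounded_0_1[OF ind] by (auto simp: A_def)
  then have "AE \<omega> in M. \<omega> \<notin> A"
    using prob_eq_0[OF A] by simp
  then show ?thesis
    using AE_space
  proof eventually_elim
    case (elim \<omega>)
    then obtain C :: nat where "\<forall>n. \<not> real C < (\<Sum>i<n. X i \<omega>)" by (auto simp: A_def)
    then show ?case by (intro exI[of _ "real C"]) (auto simp: not_less)
  qed
qed

text \<open>Subtracting a constant strictly between the mean and \<open>c\<close> reduces this to summands of negative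
  mean, whose sums are bounded and vanish after division by \<open>n\<close>.\<close>

lemma (in prob_space) sums_eventually_below_mean:
  fixes X :: "nat \<Rightarrow> 'a \<Rightarrow> real"
  assumes ind: "indep_vars (\<lambda>_. borel) X UNIV"
    and id: "\<And>i. distr M borel (X i) = distr M borel (X 0)"
    and int: "integrable M (X 0)"
    and e: "expectation (X 0) < c"
  shows "AE \<omega> in M. eventually (\<lambda>n. (\<Sum>i<n. X i \<omega>) / real n < c) sequentially"
proof -
  have rv[measurable]: "random_variable borel (X i)" for i
    using ind by (auto simp: indep_vars_def)
  \<comment> \<open>the gap between \<open>b\<close> and \<open>c\<close> absorbs the bounded term\<close>
  obtain b where b: "expectation (X 0) < b" "b < c" using dense[OF e] by blast
  define Y where "Y i \<omega> = X i \<omega> - b" for i \<omega>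
  have "AE \<omega> in M. \<exists>C. \<forall>n. (\<Sum>i<n. Y i \<omega>) \<le> C"
  proof (rule negative_mean_sums_bounded)
    show "indep_vars (\<lambda>_. borel) Y UNIV"
      unfolding Y_def by (rule indep_vars_compose2[OF ind]) simp
    show "distr M borel (Y i) = distr M borel (Y 0)" for i
    proof -
      have "distr M borel (Y i) = distr (distr M borel (X i)) borel (\<lambda>x. x - b)" for i
        by (subst distr_distr) (auto simp: Y_def[abs_def] comp_def)
      then show ?thesis by (metis id)
    qed
    show "integrable M (Y 0)" unfolding Y_def using int by simp
    show "expectation (Y 0) < 0" unfolding Y_def using int b by (simp add: prob_space)
  qed
  then show ?thesis
  proof eventually_elim
    case (elim \<omega>)
    then obtain C where C: "(\<Sum>i<n. Y i \<omega>) \<le> C" for n by blast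
    have bound: "(\<Sum>i<n. X i \<omega>) \<le> C + real n * b" for n
      using C[of n] by (simp add: Y_def sum_subtractf)
    have "(\<lambda>n. C / real n + b) \<longlonglongrightarrow> 0 + b"
      by (intro tendsto_add lim_const_over_n tendsto_const)
    then have "eventually (\<lambda>n. C / real n + b < c) sequentially"
      using b by (intro order_tendstoD(2)) auto
    then show ?case
      using eventually_gt_at_top[of 0]
    proof eventually_elim
      case (elim n)
      have "(\<Sum>i<n. X i \<omega>) / real n \<le> (C + real n * b) / real n"
        using bound by (intro divide_right_mono) auto
      also have "\<dots> = C / real n + b" using elim by (simp add: field_simps)
      finally show ?case using elim by linarith
    qed
  qed
qed

text \<open>The one-sided bound, applied to the sequence and to its negative, at countably many
  distances from the mean.\<close>

theorem (in prob_space) strong_law_of_large_numbers: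
  fixes X :: "nat \<Rightarrow> 'a \<Rightarrow> real"
  assumes ind: "indep_vars (\<lambda>_. borel) X UNIV"
    and id: "\<And>i. distr M borel (X i) = distr M borel (X 0)"
    and int: "integrable M (X 0)"
  shows "AE \<omega> in M. (\<lambda>n. (\<Sum>i<n. X i \<omega>) / real n) \<longlonglongrightarrow> expectation (X 0)"
proof -
  let ?\<mu> = "expectation (X 0)"
  have rv[measurable]: "random_variable borel (X i)" for i
    using ind by (auto simp: indep_vars_def)
  have up: "AE \<omega> in M. eventually (\<lambda>n. (\<Sum>i<n. X i \<omega>) / real n < ?\<mu> + 1 / real (Suc k)) sequentially" for k
    by (rule sums_eventually_below_mean[OF ind id int]) simp
  have "AE \<omega> in M. eventually (\<lambda>n. (\<Sum>i<n. - X i \<omega>) / real n < - ?\<mu> + 1 / real (Suc k)) sequentially" for k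
  proof (rule sums_eventually_below_mean)
    show "indep_vars (\<lambda>_. borel) (\<lambda>i \<omega>. - X i \<omega>) UNIV"
      by (rule indep_vars_compose2[OF ind]) simp
    show "distr M borel (\<lambda>\<omega>. - X i \<omega>) = distr M borel (\<lambda>\<omega>. - X 0 \<omega>)" for i
    proof -
      have "distr M borel (\<lambda>\<omega>. - X i \<omega>) = distr (distr M borel (X i)) borel uminus" for i
        by (subst distr_distr) (auto simp: comp_def)
      then show ?thesis by (metis id)
    qed
  qed (use int in auto)
  then have "AE \<omega> in M. \<forall>k. eventually (\<lambda>n. (\<Sum>i<n. - X i \<omega>) / real n < - ?\<mu> + 1 / real (Suc k)) sequentially"
    by (simp add: AE_all_countable)
  moreover have "AE \<omega> in M. \<forall>k. eventually (\<lambda>n. (\<Sum>i<n. X i \<omega>) / real n < ?\<mu> + 1 / real (Suc k)) sequentially"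
    using up by (simp add: AE_all_countable)
  ultimately show ?thesis
  proof eventually_elim
    case (elim \<omega>)
    show ?case
    proof (rule LIMSEQ_I)
      fix e :: real assume "0 < e"
      then obtain k where k: "1 / real (Suc k) < e" using nat_approx_posE by blast
      have "eventually (\<lambda>n. norm ((\<Sum>i<n. X i \<omega>) / real n - ?\<mu>) < e) sequentially"
        using elim(1)[rule_format, of k] elim(2)[rule_format, of k]
      proof eventually_elim
        case (elim n)
        have "(\<Sum>i<n. - X i \<omega>) / real n = - ((\<Sum>i<n. X i \<omega>) / real n)" by (simp add: sum_negf)
        then show ?case using elim k by (simp add: abs_less_iff)
      qed
      then show "\<exists>no. \<forall>n\<ge>no. norm ((\<Sum>i<n. X i \<omega>) / real n - ?\<mu>) < e"
        by (simp add: eventually_sequentially)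
    qed
  qed
qed

section \<open>Discrete laws and independence\<close>

text \<open>Two probability measures cannot be strictly ordered: if \<open>p\<close> is dominated atom by atom, then it is
  dominated on every set, and on every complement, while both total masses are \<open>1\<close>. Lower bounds
  on the probabilities of atoms hence suffice to identify a law.\<close>

lemma prob_eq_measure_pmf:
  assumes "prob_space N" and sets: "sets N = UNIV"
    and le: "\<And>x. pmf p x \<le> measure N {x}"
  shows "N = measure_pmf p"
proof -
  interpret N: prob_space N by fact
  have space: "space N = UNIV" using sets_eq_imp_space_eq[of N "count_space UNIV"] sets by simp
  have ge: "measure (measure_pmf p) A \<le> measure N A" for A
  proof -
    let ?B = "A \<inter> set_pmf p"
    have cB: "countable ?B" by auto
    have "emeasure (measure_pmf p) A = emeasure (measure_pmf p) ?B"
      by (simp add: emeasure_Int_set_pmf)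
    also have "\<dots> = (\<integral>\<^sup>+x. emeasure (measure_pmf p) {x} \<partial>count_space ?B)"
      by (rule emeasure_countable_singleton) (use cB in auto)
    also have "\<dots> \<le> (\<integral>\<^sup>+x. emeasure N {x} \<partial>count_space ?B)"
      using le by (intro nn_integral_mono) (simp add: emeasure_pmf_single N.emeasure_eq_measure ennreal_leI)
    also have "\<dots> = emeasure N ?B"
      by (rule emeasure_countable_singleton[symmetric]) (use cB sets in auto)
    also have "\<dots> \<le> emeasure N A" by (rule emeasure_mono) (use sets in auto)
    finally show ?thesis
      by (simp add: measure_pmf.emeasure_eq_measure N.emeasure_eq_measure)
  qed
  show ?thesis
  proof (rule measure_eqI)
    fix A assume "A \<in> sets N"
    have "measure N (UNIV - A) = 1 - measure N A"
      using N.prob_compl[of A] space sets by simp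
    moreover have "measure (measure_pmf p) (UNIV - A) = 1 - measure (measure_pmf p) A"
      using measure_pmf.prob_compl[of A p] by simp
    ultimately have "measure N A = measure (measure_pmf p) A"
      using ge[of A] ge[of "UNIV - A"] by linarith
    then show "emeasure N A = emeasure (measure_pmf p) A"
      by (simp add: measure_pmf.emeasure_eq_measure N.emeasure_eq_measure)
  qed (simp add: sets)
qed

text \<open>Product laws of all initial segments give independence of the whole sequence. The value \<open>c\<close> fills
  the coordinates beyond the segment, as product laws on functions require.\<close>

lemma (in prob_space) indep_vars_count_spaceI:
  assumes meas: "\<And>j :: nat. Y j \<in> measurable M (count_space UNIV)"
    and law: "\<And>k. distr M (count_space UNIV) (\<lambda>\<omega> j. if j < k then Y j \<omega> else c)
                 = measure_pmf (Pi_pmf {..<k} c (\<lambda>_. D))"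
    and vmeas: "\<And>k. (\<lambda>\<omega> j. if j < k then Y j \<omega> else c) \<in> measurable M (count_space UNIV)"
  shows "indep_vars (\<lambda>_. count_space UNIV) Y UNIV"
    and "distr M (count_space UNIV) (Y j) = measure_pmf D"
proof -
  have rect: "prob {\<omega> \<in> space M. \<forall>j<k. Y j \<omega> \<in> B j} = (\<Prod>j<k. measure_pmf.prob D (B j))" for k B
  proof -
    have "prob {\<omega> \<in> space M. \<forall>j<k. Y j \<omega> \<in> B j}
        = measure (distr M (count_space UNIV) (\<lambda>\<omega> j. if j < k then Y j \<omega> else c)) (Pi {..<k} B)"
      using vmeas[of k] by (subst measure_distr) (auto intro!: arg_cong[where f=prob] simp: Pi_def)
    also have "\<dots> = (\<Prod>j<k. measure_pmf.prob D (B j))"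
      unfolding law by (rule measure_Pi_pmf_Pi) simp
    finally show ?thesis .
  qed
  have single: "prob {\<omega> \<in> space M. Y j \<omega> \<in> B} = measure_pmf.prob D B" for j B
  proof -
    have "prob {\<omega> \<in> space M. \<forall>i<Suc j. Y i \<omega> \<in> (if i = j then B else UNIV)}
        = (\<Prod>i<Suc j. measure_pmf.prob D (if i = j then B else UNIV))"
      by (rule rect)
    also have "{\<omega> \<in> space M. \<forall>i<Suc j. Y i \<omega> \<in> (if i = j then B else UNIV)} = {\<omega> \<in> space M. Y j \<omega> \<in> B}"
      by auto
    also have "(\<Prod>i<Suc j. measure_pmf.prob D (if i = j then B else UNIV)) = measure_pmf.prob D B"
      by simp
    finally show ?thesis .
  qed
  show "distr M (count_space UNIV) (Y j) = measure_pmf D"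
  proof (rule measure_eqI)
    fix B assume "B \<in> sets (distr M (count_space UNIV) (Y j))"
    have "emeasure (distr M (count_space UNIV) (Y j)) B = emeasure M {\<omega> \<in> space M. Y j \<omega> \<in> B}"
      using meas[of j] by (subst emeasure_distr) (auto intro!: arg_cong[where f="emeasure M"])
    then show "emeasure (distr M (count_space UNIV) (Y j)) B = emeasure (measure_pmf D) B"
      using single[of j B] by (simp add: emeasure_eq_measure measure_pmf.emeasure_eq_measure)
  qed simp
  have ev: "Y i -` B \<inter> space M \<in> events" for i B
    using measurable_sets[OF meas] by simp
  let ?F = "\<lambda>i. {Y i -` B \<inter> space M | B. B \<in> sets (count_space UNIV)}"
  have init: "indep_sets ?F {..<Suc k}" for k
  proof (subst indep_sets_finite)
    show "space M \<in> ?F i" for i by (auto intro!: exI[of _ UNIV])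
    show "\<forall>A\<in>Pi {..<Suc k} ?F. prob (\<Inter>j\<in>{..<Suc k}. A j) = (\<Prod>j<Suc k. prob (A j))"
    proof
      fix A assume "A \<in> Pi {..<Suc k} ?F"
      then have "\<forall>j\<in>{..<Suc k}. \<exists>B. A j = Y j -` B \<inter> space M" by (auto simp: Pi_def)
      then obtain B where B: "\<And>j. j < Suc k \<Longrightarrow> A j = Y j -` B j \<inter> space M"
        by (metis lessThan_iff)
      have "(\<Inter>j\<in>{..<Suc k}. A j) = {\<omega> \<in> space M. \<forall>j<Suc k. Y j \<omega> \<in> B j}"
        using B by auto
      moreover have "prob (A j) = measure_pmf.prob D (B j)" if "j < Suc k" for j
      proof -
        have "A j = {\<omega> \<in> space M. Y j \<omega> \<in> B j}" using B[OF that] by auto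
        then show ?thesis by (simp add: single)
      qed
      ultimately show "prob (\<Inter>j\<in>{..<Suc k}. A j) = (\<Prod>j<Suc k. prob (A j))"
        by (simp add: rect del: prod.lessThan_Suc)
    qed
  qed (auto simp: ev lessThan_empty_iff)
  have "indep_sets ?F UNIV"
  proof (subst indep_sets_finite_index_sets, intro allI impI)
    fix J :: "nat set" assume "finite J"
    then have "J \<subseteq> {..<Suc (Max J)}" by (auto simp: less_Suc_eq_le)
    then show "indep_sets ?F J" by (rule indep_sets_mono_index) (rule init)
  qed
  then show "indep_vars (\<lambda>_. count_space UNIV) Y UNIV"
    using meas by (simp add: indep_vars_def2)
qed

text \<open>Tonelli for the region \<open>t < f x\<close>. Weights \<open>g t = 1\<close> and \<open>g t = 2 * t + 1\<close> have the partial sums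
  \<open>n\<close> and \<open>n\<^sup>2\<close>, so that first and second moments are read off from the tails.\<close>

lemma nn_integral_sum_below:
  fixes N :: "'a measure" and f :: "'a \<Rightarrow> nat" and g :: "nat \<Rightarrow> real"
  assumes [measurable]: "f \<in> measurable N (count_space UNIV)" and g: "\<And>t. 0 \<le> g t"
  shows "(\<integral>\<^sup>+x. ennreal (\<Sum>t<f x. g t) \<partial>N)
       = (\<Sum>t. ennreal (g t) * emeasure N {x \<in> space N. t < f x})"
proof -
  have eq: "ennreal (\<Sum>t<n. g t) = (\<Sum>t. ennreal (g t) * indicator {..<n} t)" for n
  proof -
    have "(\<Sum>t. ennreal (g t) * indicator {..<n} t) = (\<Sum>t<n. ennreal (g t) * indicator {..<n} t)"
      by (rule suminf_finite) auto
    also have "\<dots> = (\<Sum>t<n. ennreal (g t))" by (rule sum.cong) auto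
    also have "\<dots> = ennreal (\<Sum>t<n. g t)" using g by (intro sum_ennreal) auto
    finally show ?thesis ..
  qed
  have "(\<integral>\<^sup>+x. ennreal (\<Sum>t<f x. g t) \<partial>N) = (\<integral>\<^sup>+x. (\<Sum>t. ennreal (g t) * indicator {x \<in> space N. t < f x} x) \<partial>N)"
    unfolding eq by (intro nn_integral_cong suminf_cong) (auto simp: indicator_def)
  also have "\<dots> = (\<Sum>t. \<integral>\<^sup>+x. ennreal (g t) * indicator {x \<in> space N. t < f x} x \<partial>N)"
    by (intro nn_integral_suminf) measurable
  also have "\<dots> = (\<Sum>t. ennreal (g t) * emeasure N {x \<in> space N. t < f x})"
    by (intro suminf_cong) (subst nn_integral_cmult_indicator; measurable)
  finally show ?thesis .
qed

lemma expectation_sum_below: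
  fixes p :: "nat pmf" and g :: "nat \<Rightarrow> real"
  assumes g: "\<And>t. 0 \<le> g t"
    and tail: "\<And>t. measure_pmf.prob p {t<..} = s t"
    and sum: "summable (\<lambda>t. g t * s t)"
  shows "integrable (measure_pmf p) (\<lambda>n. \<Sum>t<n. g t)"
    and "measure_pmf.expectation p (\<lambda>n. \<Sum>t<n. g t) = (\<Sum>t. g t * s t)"
proof -
  have s: "0 \<le> s t" for t using tail[of t] by (metis measure_nonneg)
  have nonneg: "0 \<le> g t * s t" for t using g s by simp
  have "(\<integral>\<^sup>+n. ennreal (\<Sum>t<n. g t) \<partial>measure_pmf p)
      = (\<Sum>t. ennreal (g t) * emeasure (measure_pmf p) {n. t < n})"
    using nn_integral_sum_below[of "\<lambda>n. n" "measure_pmf p" g] g by simp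
  also have "\<dots> = (\<Sum>t. ennreal (g t * s t))"
    using tail g s by (intro suminf_cong)
      (simp add: measure_pmf.emeasure_eq_measure ennreal_mult greaterThan_def)
  also have "\<dots> = ennreal (\<Sum>t. g t * s t)"
    by (rule suminf_ennreal2[OF nonneg sum])
  finally have nn: "(\<integral>\<^sup>+n. ennreal (\<Sum>t<n. g t) \<partial>measure_pmf p) = ennreal (\<Sum>t. g t * s t)" .
  show "integrable (measure_pmf p) (\<lambda>n. \<Sum>t<n. g t)"
    using nn g by (intro integrableI_nonneg) (auto intro: sum_nonneg)
  show "measure_pmf.expectation p (\<lambda>n. \<Sum>t<n. g t) = (\<Sum>t. g t * s t)"
    using nn g suminf_nonneg[OF sum nonneg]
    by (intro integral_eq_nn_integral[THEN trans]) (auto intro: sum_nonneg)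
qed

section \<open>The law of a sojourn\<close>

lemma surv_1: "surv \<alpha> i (Suc 0) = 1"
  by (simp add: surv_def)

lemma surv_Suc: "surv \<alpha> i (Suc (Suc n)) = surv \<alpha> i (Suc n) * (1 - \<alpha> i (Suc n))"
proof -
  have "{1..<Suc (Suc n)} = insert (Suc n) {1..<Suc n}" by auto
  then show ?thesis by (simp add: surv_def)
qed

text \<open>The probability to stay for \<open>t - 1\<close> steps at the ages \<open>1, \<dots>, t - 1\<close> and to leave at age \<open>t\<close>.
  A sojourn lasts at least one step, which excludes \<open>t = 0\<close>.\<close>

definition sojourn_prob :: "(nat \<Rightarrow> nat \<Rightarrow> real) \<Rightarrow> nat \<Rightarrow> nat \<Rightarrow> real" where
  "sojourn_prob \<alpha> i t = (if t = 0 then 0 else surv \<alpha> i t * \<alpha> i t)"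

definition sojourn_pmf :: "(nat \<Rightarrow> nat \<Rightarrow> real) \<Rightarrow> nat \<Rightarrow> nat pmf" where
  "sojourn_pmf \<alpha> i = embed_pmf (sojourn_prob \<alpha> i)"

lemma sum_sojourn_prob: "(\<Sum>t\<le>m. sojourn_prob \<alpha> i t) = 1 - surv \<alpha> i (Suc m)"
  by (induction m) (simp_all add: sojourn_prob_def surv_1 surv_Suc algebra_simps)

locale sojourns =
  fixes \<alpha> :: "nat \<Rightarrow> nat \<Rightarrow> real" and i :: nat
  assumes rate: "\<And>n. n \<ge> 1 \<Longrightarrow> 0 < \<alpha> i n \<and> \<alpha> i n < 1"
    and summ: "summable (\<lambda>n. surv \<alpha> i (Suc n))"
begin

lemma surv_pos: "0 < surv \<alpha> i m"
  unfolding surv_def using rate by (intro prod_pos) auto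

lemma sojourn_prob_nonneg: "0 \<le> sojourn_prob \<alpha> i t"
  using rate[of t] surv_pos[of t] by (auto simp: sojourn_prob_def)

text \<open>The weights telescope to \<open>1 - surv \<alpha> i (Suc m)\<close>; they sum to \<open>1\<close> because the terms of a
  convergent series vanish. In other words, a sojourn of finite expected length ends almost surely.\<close>

lemma pmf_sojourn: "pmf (sojourn_pmf \<alpha> i) t = sojourn_prob \<alpha> i t"
  unfolding sojourn_pmf_def
proof (rule pmf_embed_pmf)
  have "(\<lambda>m. \<Sum>t\<le>m. sojourn_prob \<alpha> i t) \<longlonglongrightarrow> 1 - 0"
    unfolding sum_sojourn_prob using summable_LIMSEQ_zero[OF summ] by (intro tendsto_diff tendsto_const)
  then have "sojourn_prob \<alpha> i sums 1" by (simp add: sums_def_le)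
  then show "(\<integral>\<^sup>+t. ennreal (sojourn_prob \<alpha> i t) \<partial>count_space UNIV) = 1"
    by (simp add: nn_integral_count_space_nat suminf_ennreal2 sojourn_prob_nonneg sums_iff)
qed (rule sojourn_prob_nonneg)

lemma sojourn_tail: "measure_pmf.prob (sojourn_pmf \<alpha> i) {t<..} = surv \<alpha> i (Suc t)"
proof -
  have "measure_pmf.prob (sojourn_pmf \<alpha> i) {..t} = 1 - surv \<alpha> i (Suc t)"
    by (simp add: measure_measure_pmf_finite pmf_sojourn sum_sojourn_prob)
  moreover have "{t<..} = UNIV - {..t}" by auto
  ultimately show ?thesis
    using measure_pmf.prob_compl[of "{..t}" "sojourn_pmf \<alpha> i"] by simp
qed

lemma sojourn_pos: "t \<in> set_pmf (sojourn_pmf \<alpha> i) \<Longrightarrow> 0 < t"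
  by (rule ccontr) (auto simp: set_pmf_iff pmf_sojourn sojourn_prob_def)

lemma sojourn_support: "0 < t \<Longrightarrow> t \<in> set_pmf (sojourn_pmf \<alpha> i)"
  using rate[of t] surv_pos[of t] by (auto simp: set_pmf_iff pmf_sojourn sojourn_prob_def)

lemma sojourn_integrable: "integrable (measure_pmf (sojourn_pmf \<alpha> i)) real"
  and sojourn_mean: "measure_pmf.expectation (sojourn_pmf \<alpha> i) real = Theta \<alpha> i"
  using expectation_sum_below[of "\<lambda>_. 1", OF _ sojourn_tail] summ by (simp_all add: Theta_def)

lemma sojourn_square_integrable:
  assumes "summable (\<lambda>k. real (Suc k) * surv \<alpha> i (Suc k))"
  shows "integrable (measure_pmf (sojourn_pmf \<alpha> i)) (\<lambda>t. (real t)\<^sup>2)"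
proof -
  have sq: "(\<Sum>t<n. 2 * real t + 1) = (real n)\<^sup>2" for n
    by (induction n) (auto simp: power2_eq_square algebra_simps)
  have "summable (\<lambda>t. (2 * real t + 1) * surv \<alpha> i (Suc t))"
  proof (rule summable_comparison_test')
    show "summable (\<lambda>k. 2 * (real (Suc k) * surv \<alpha> i (Suc k)))"
      using assms by (rule summable_mult)
    show "norm ((2 * real k + 1) * surv \<alpha> i (Suc k)) \<le> 2 * (real (Suc k) * surv \<alpha> i (Suc k))"
      if "k \<ge> 0" for k
    proof -
      have "(2 * real k + 1) * surv \<alpha> i (Suc k) \<le> (2 * real (Suc k)) * surv \<alpha> i (Suc k)"
        using surv_pos[of "Suc k"] by (intro mult_right_mono) auto
      then show ?thesis using surv_pos[of "Suc k"] by (simp add: abs_mult)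
    qed
  qed
  from expectation_sum_below(1)[of "\<lambda>t. 2 * real t + 1", OF _ sojourn_tail this]
  show ?thesis by (simp add: sq)
qed

lemma Theta_ge_1: "1 \<le> Theta \<alpha> i"
proof -
  have "(\<Sum>n<1. surv \<alpha> i (Suc n)) \<le> Theta \<alpha> i"
    unfolding Theta_def using summ surv_pos by (intro sum_le_suminf) (auto intro: less_imp_le)
  then show ?thesis by (simp add: surv_1)
qed

end

section \<open>Renewal times and the index of the current cycle\<close>

text \<open>Cycle number \<open>k\<close> has length \<open>l k\<close> and occupies the times from \<open>renewal l k\<close> up to, but not including,
  \<open>renewal l (Suc k)\<close>.\<close>

definition renewal :: "(nat \<Rightarrow> nat) \<Rightarrow> nat \<Rightarrow> nat" where
  "renewal l k = (\<Sum>j<k. l j)"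

definition cycle_of :: "(nat \<Rightarrow> nat) \<Rightarrow> nat \<Rightarrow> nat" where
  "cycle_of l n = (LEAST k. n < renewal l (Suc k))"

lemma renewal_0 [simp]: "renewal l 0 = 0"
  and renewal_Suc [simp]: "renewal l (Suc k) = renewal l k + l k"
  by (simp_all add: renewal_def)

lemma renewal_mono: "j \<le> k \<Longrightarrow> renewal l j \<le> renewal l k"
  unfolding renewal_def by (intro sum_mono2) auto

lemma renewal_ge: "(\<And>j. 0 < l j) \<Longrightarrow> k \<le> renewal l k"
proof (induction k)
  case (Suc k)
  then show ?case using Suc.prems[of k] by (auto simp: Suc_le_eq intro: le_less_trans)
qed simp

lemma cycle_of_bounds:
  assumes "\<And>j. 0 < l j"
  shows "renewal l (cycle_of l n) \<le> n" "n < renewal l (Suc (cycle_of l n))"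
proof -
  have ex: "n < renewal l (Suc n)"
    using renewal_ge[of l "Suc n", OF assms] by simp
  then show "n < renewal l (Suc (cycle_of l n))"
    unfolding cycle_of_def by (rule LeastI)
  show "renewal l (cycle_of l n) \<le> n"
  proof (cases "cycle_of l n")
    case (Suc k)
    then have "\<not> n < renewal l (Suc k)"
      unfolding cycle_of_def by (intro not_less_Least) simp
    then show ?thesis using Suc by simp
  qed simp
qed

lemma renewal_le_iff:
  assumes "\<And>j. 0 < l j"
  shows "renewal l j \<le> n \<longleftrightarrow> j \<le> cycle_of l n"
proof
  assume "renewal l j \<le> n"
  show "j \<le> cycle_of l n"
  proof (rule ccontr)
    assume "\<not> j \<le> cycle_of l n"
    then have "renewal l (Suc (cycle_of l n)) \<le> renewal l j" by (intro renewal_mono) simp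
    then show False using cycle_of_bounds(2)[of l n, OF assms] \<open>renewal l j \<le> n\<close> by simp
  qed
next
  assume "j \<le> cycle_of l n"
  then show "renewal l j \<le> n"
    using renewal_mono[of j "cycle_of l n" l] cycle_of_bounds(1)[of l n, OF assms] by simp
qed

lemma cycle_of_eq:
  assumes "\<And>j. 0 < l j" "renewal l k \<le> n" "n < renewal l (Suc k)"
  shows "cycle_of l n = k"
  using renewal_le_iff[of l k n, OF assms(1)] renewal_le_iff[of l "Suc k" n, OF assms(1)] assms(2,3)
  by simp

lemma cycle_of_le: "(\<And>j. 0 < l j) \<Longrightarrow> cycle_of l n \<le> n"
  using cycle_of_bounds(1)[of l n] renewal_ge[of l "cycle_of l n"] by simp

section \<open>Trajectories and their cycles\<close>

definition cyc_len :: "nat \<times> nat \<Rightarrow> nat" where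
  "cyc_len p = fst p + snd p"

abbreviation start :: "(nat \<Rightarrow> nat \<times> nat) \<Rightarrow> nat \<Rightarrow> nat" where
  "start y \<equiv> renewal (\<lambda>j. cyc_len (y j))"

definition pos_cycles :: "(nat \<Rightarrow> nat \<times> nat) \<Rightarrow> bool" where
  "pos_cycles y \<longleftrightarrow> (\<forall>j. 0 < fst (y j) \<and> 0 < snd (y j))"

text \<open>The path of the chain whose sojourns in the states \<open>1\<close> and \<open>- 1\<close> during cycle \<open>k\<close> have the lengths
  \<open>fst (y k)\<close> and \<open>snd (y k)\<close>; the second component is the age in the current state.\<close>

definition alternating :: "(nat \<Rightarrow> nat \<times> nat) \<Rightarrow> nat \<Rightarrow> real \<times> nat" where
  "alternating y n =
     (let k = cycle_of (\<lambda>j. cyc_len (y j)) n; m = n - start y k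
      in if m < fst (y k) then (1, Suc m) else (- 1, Suc (m - fst (y k))))"

lemma pos_cyc_len: "pos_cycles y \<Longrightarrow> 0 < cyc_len (y j)"
  by (auto simp: pos_cycles_def cyc_len_def)

lemma cycle_of_start:
  assumes "pos_cycles y" "m < cyc_len (y k)"
  shows "cycle_of (\<lambda>j. cyc_len (y j)) (start y k + m) = k"
  using assms by (intro cycle_of_eq) (auto intro: pos_cyc_len)

lemma alternating_up:
  assumes "pos_cycles y" "i < fst (y k)"
  shows "alternating y (start y k + i) = (1, Suc i)"
  using cycle_of_start[OF assms(1), of i k] assms(2) by (simp add: alternating_def cyc_len_def)

lemma alternating_down:
  assumes "pos_cycles y" "i < snd (y k)"
  shows "alternating y (start y k + fst (y k) + i) = (- 1, Suc i)"
  using cycle_of_start[OF assms(1), of "fst (y k) + i" k] assms(2)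
  by (simp add: alternating_def cyc_len_def add.assoc)

lemma alternating_start: "pos_cycles y \<Longrightarrow> alternating y (start y k) = (1, Suc 0)"
  using alternating_up[of y 0 k] by (simp add: pos_cycles_def)

lemma before_start_cases:
  assumes "pos_cycles y" "n < start y k"
  obtains j i where "j < k" "n = start y j + i" "i < fst (y j)"
  | j i where "j < k" "n = start y j + fst (y j) + i" "i < snd (y j)"
proof -
  let ?j = "cycle_of (\<lambda>j. cyc_len (y j)) n"
  have pos: "\<And>j. 0 < cyc_len (y j)" using assms(1) by (rule pos_cyc_len)
  have b: "start y ?j \<le> n" "n < start y (Suc ?j)"
    using cycle_of_bounds[of "\<lambda>j. cyc_len (y j)" n] pos by auto
  have j: "?j < k"
    using renewal_le_iff[of "\<lambda>j. cyc_len (y j)" k n] pos assms(2) by auto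
  show thesis
  proof (cases "n - start y ?j < fst (y ?j)")
    case True
    then show thesis using that(1)[OF j, of "n - start y ?j"] b by simp
  next
    case False
    then show thesis using that(2)[OF j, of "n - start y ?j - fst (y ?j)"] b
      by (simp add: cyc_len_def)
  qed
qed

lemma start_cong: "(\<And>j. j < k \<Longrightarrow> y j = y' j) \<Longrightarrow> start y k = start y' k"
  unfolding renewal_def by (rule sum.cong) auto

lemma alternating_cong:
  assumes "pos_cycles y" "pos_cycles y'" and eq: "\<And>j. j < k \<Longrightarrow> y j = y' j" and "n \<le> start y k"
  shows "alternating y n = alternating y' n"
proof (cases "n = start y k")
  case True
  then show ?thesis
    using start_cong[of k y y'] eq alternating_start[OF assms(1), of k] alternating_start[OF assms(2), of k]
    by simp
next
  case False
  then have "n < start y k" using assms(4) by simp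
  with assms(1) show ?thesis
  proof (cases rule: before_start_cases)
    case (1 j i)
    moreover have "start y j = start y' j" using 1(1) eq by (intro start_cong) auto
    ultimately show ?thesis
      using alternating_up[OF assms(1), of i j] alternating_up[OF assms(2), of i j] eq[of j] by simp
  next
    case (2 j i)
    moreover have "start y j = start y' j" using 2(1) eq by (intro start_cong) auto
    ultimately show ?thesis
      using alternating_down[OF assms(1), of i j] alternating_down[OF assms(2), of i j] eq[of j] by simp
  qed
qed

lemma alternating_in_states: "alternating y n \<in> states"
  by (auto simp: alternating_def states_def a_def Let_def)

text \<open>The length of the stretch with value \<open>c\<close> beginning at time \<open>s\<close>. The value at \<open>s\<close> itself is not
  inspected: this keeps the length positive on every path, so that the cycles read off from
  an arbitrary path are well formed.\<close>

definition run :: "(nat \<Rightarrow> real) \<Rightarrow> real \<Rightarrow> nat \<Rightarrow> nat" where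
  "run x c s = Suc (LEAST i. x (s + Suc i) \<noteq> c)"

primrec cyc_start :: "(nat \<Rightarrow> real) \<Rightarrow> nat \<Rightarrow> nat" where
  "cyc_start x 0 = 0"
| "cyc_start x (Suc j) = cyc_start x j + run x 1 (cyc_start x j)
     + run x (- 1) (cyc_start x j + run x 1 (cyc_start x j))"

definition cyc :: "(nat \<Rightarrow> real) \<Rightarrow> nat \<Rightarrow> nat \<times> nat" where
  "cyc x j = (run x 1 (cyc_start x j), run x (- 1) (cyc_start x j + run x 1 (cyc_start x j)))"

lemma pos_cycles_cyc: "pos_cycles (cyc x)"
  by (simp add: pos_cycles_def cyc_def run_def)

lemma start_cyc: "start (cyc x) k = cyc_start x k"
  by (induction k) (simp_all add: cyc_len_def cyc_def)

lemma run_eqI: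
  assumes "0 < t" and eq: "\<And>i. i < t \<Longrightarrow> x (s + i) = c" and "x (s + t) \<noteq> c"
  shows "run x c s = t"
proof -
  obtain t' where t: "t = Suc t'" using assms(1) gr0_conv_Suc by blast
  have "(LEAST i. x (s + Suc i) \<noteq> c) = t'"
  proof (rule Least_equality)
    show "x (s + Suc t') \<noteq> c" using assms(3) t by simp
    fix i assume "x (s + Suc i) \<noteq> c"
    then have "\<not> Suc i < t" using eq[of "Suc i"] by auto
    then show "t' \<le> i" using t by simp
  qed
  then show ?thesis by (simp add: run_def t)
qed

text \<open>A path that agrees with an alternating one up to the beginning of cycle \<open>k\<close> determines the
  cycles before \<open>k\<close>. The horizon is finite because only finite cylinders have computable
  probabilities.\<close>

lemma cyc_of_alternating:
  assumes y: "pos_cycles y" and x: "\<And>n. n \<le> start y k \<Longrightarrow> x n = fst (alternating y n)"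
  shows "j \<le> k \<Longrightarrow> cyc_start x j = start y j" and "j < k \<Longrightarrow> cyc x j = y j"
proof -
  have step: "cyc x j = y j" if j: "j < k" and s: "cyc_start x j = start y j" for j
  proof -
    \<comment> \<open>the whole cycle \<open>j\<close> and the first time after it lie within the horizon\<close>
    have len: "start y j + cyc_len (y j) \<le> start y k"
      using renewal_mono[of "Suc j" k "\<lambda>j. cyc_len (y j)"] j by simp
    have pos: "0 < fst (y j)" "0 < snd (y j)" using y by (auto simp: pos_cycles_def)
    have up: "x (start y j + i) = 1" if "i < fst (y j)" for i
      using x[of "start y j + i"] alternating_up[OF y that] len that by (simp add: cyc_len_def)
    have down: "x (start y j + fst (y j) + i) = - 1" if "i < snd (y j)" for i
      using x[of "start y j + fst (y j) + i"] alternating_down[OF y that] len that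
      by (simp add: cyc_len_def)
    have last: "x (start y j + fst (y j) + snd (y j)) = 1"
      using x[of "start y (Suc j)"] alternating_start[OF y, of "Suc j"] len
      by (simp add: cyc_len_def add.assoc)
    have r1: "run x 1 (start y j) = fst (y j)"
      using up down[of 0] pos by (intro run_eqI) auto
    have r2: "run x (- 1) (start y j + fst (y j)) = snd (y j)"
      using down last pos by (intro run_eqI) auto
    show ?thesis by (simp add: cyc_def s r1 r2)
  qed
  have st: "cyc_start x j = start y j" if "j \<le> k" for j
    using that
  proof (induction j)
    case (Suc j)
    then have "cyc x j = y j" using step by simp
    then show ?case using Suc by (simp add: start_cyc[symmetric])
  qed simp
  show "j \<le> k \<Longrightarrow> cyc_start x j = start y j" by (rule st)
  show "j < k \<Longrightarrow> cyc x j = y j" using step st by simp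
qed

section \<open>The cycles of the chain are independent and identically distributed\<close>

text \<open>Once a history has probability zero, both sides stay zero, so the exemption of such histories in
  the definition of a Markov chain does no harm.\<close>

lemma markov_chain_path_prob:
  assumes mc: "markov_chain P E p Z" and z: "\<And>n. z n \<in> E"
  shows "measure P {\<omega> \<in> space P. \<forall>k\<le>n. Z k \<omega> = z k}
       = measure P {\<omega> \<in> space P. Z 0 \<omega> = z 0} * (\<Prod>k<n. p (z k) (z (Suc k)))"
proof (induction n)
  case (Suc n)
  interpret prob_space P using mc by (simp add: markov_chain_def)
  have [measurable]: "Z k \<in> measurable P (count_space E)" for k
    using mc by (simp add: markov_chain_def)
  let ?A = "{\<omega> \<in> space P. \<forall>k\<le>n. Z k \<omega> = z k}" and ?B = "{\<omega> \<in> space P. \<forall>k\<le>Suc n. Z k \<omega> = z k}"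
  have BA: "?B = {\<omega> \<in> space P. Z (Suc n) \<omega> = z (Suc n) \<and> (\<forall>k\<le>n. Z k \<omega> = z k)}"
    by (auto simp: le_Suc_eq)
  have "measure P ?B = measure P ?A * p (z n) (z (Suc n))"
  proof (cases "measure P ?A > 0")
    case True
    then have "\<P>(\<omega> in P. Z (Suc n) \<omega> = z (Suc n) \<bar> \<forall>k\<le>n. Z k \<omega> = z k) = p (z n) (z (Suc n))"
      using mc z unfolding markov_chain_def by blast
    then have "measure P ?B / measure P ?A = p (z n) (z (Suc n))"
      unfolding cond_prob_def BA .
    then show ?thesis using True by (simp add: field_simps)
  next
    case False
    then have A0: "measure P ?A = 0" by (simp add: zero_less_measure_iff)
    have "?A \<in> sets P" by measurable
    then have "measure P ?B \<le> measure P ?A" by (intro finite_measure_mono) auto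
    then have "measure P ?B = 0" using A0 measure_nonneg[of P ?B] by linarith
    then show ?thesis using A0 by simp
  qed
  then show ?case using Suc by (simp add: mult.assoc)
qed simp

lemma prod_lessThan_add:
  fixes f :: "nat \<Rightarrow> 'b::comm_monoid_mult"
  shows "(\<Prod>i<m + n. f i) = (\<Prod>i<m. f i) * (\<Prod>i<n. f (m + i))"
  by (induction n) (simp_all add: mult.assoc)

lemma sojourn_transitions:
  assumes "0 < t" and stay: "\<And>i. i < t \<Longrightarrow> f i = (x, Suc i)" and "f t = (y, 1)" "y \<noteq> x"
  shows "(\<Prod>i<t. trans_prob \<alpha> (f i) (f (Suc i))) = sojourn_prob \<alpha> (idx x) t"
proof -
  obtain s where t: "t = Suc s" using assms(1) gr0_conv_Suc by blast
  have "(\<Prod>i<s. trans_prob \<alpha> (f i) (f (Suc i))) = (\<Prod>i<s. 1 - \<alpha> (idx x) (Suc i))"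
    by (rule prod.cong) (auto simp: stay t trans_prob_def)
  also have "\<dots> = surv \<alpha> (idx x) (Suc s)"
    by (induction s) (simp_all add: surv_1 surv_Suc)
  finally show ?thesis
    using assms by (simp add: t sojourn_prob_def trans_prob_def)
qed

text \<open>The trajectory starts in the state \<open>1\<close>, which has index \<open>2\<close>; hence the order of the factors.\<close>

definition cycle_pmf :: "(nat \<Rightarrow> nat \<Rightarrow> real) \<Rightarrow> (nat \<times> nat) pmf" where
  "cycle_pmf \<alpha> = pair_pmf (sojourn_pmf \<alpha> 2) (sojourn_pmf \<alpha> 1)"

locale sign_chain = prob_space P
  for P :: "'w measure" and \<alpha> :: "nat \<Rightarrow> nat \<Rightarrow> real"
    and X :: "nat \<Rightarrow> 'w \<Rightarrow> real" and M :: "nat \<Rightarrow> 'w \<Rightarrow> nat" +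
  assumes rate: "\<And>i n. i \<in> {1, 2} \<Longrightarrow> n \<ge> 1 \<Longrightarrow> 0 < \<alpha> i n \<and> \<alpha> i n < 1"
    and markov: "markov_chain P states (trans_prob \<alpha>) (\<lambda>n \<omega>. (X n \<omega>, M n \<omega>))"
    and init: "AE \<omega> in P. X 0 \<omega> = 1 \<and> M 0 \<omega> = 1"
    and summ: "\<And>i. i \<in> {1, 2} \<Longrightarrow> summable (\<lambda>n. surv \<alpha> i (Suc n))"
begin

sublocale down: sojourns \<alpha> 1
  using rate[of 1] summ[of 1] by unfold_locales auto

sublocale up: sojourns \<alpha> 2
  using rate[of 2] summ[of 2] by unfold_locales auto

lemma pmf_cycle: "pmf (cycle_pmf \<alpha>) p = sojourn_prob \<alpha> 2 (fst p) * sojourn_prob \<alpha> 1 (snd p)"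
  by (cases p) (simp add: cycle_pmf_def pmf_pair up.pmf_sojourn down.pmf_sojourn del: One_nat_def)

lemma Z_measurable [measurable]: "(\<lambda>\<omega>. (X n \<omega>, M n \<omega>)) \<in> measurable P (count_space states)"
  using markov by (simp add: markov_chain_def)

lemma X_measurable_discrete [measurable]: "X n \<in> measurable P (count_space UNIV)"
proof -
  have "(\<lambda>\<omega>. fst (X n \<omega>, M n \<omega>)) \<in> measurable P (count_space UNIV)"
    by (rule measurable_compose[OF Z_measurable]) simp
  then show ?thesis by simp
qed

lemma X_measurable: "X n \<in> borel_measurable P"
  by (rule measurable_compose[OF X_measurable_discrete, of "\<lambda>x. x"]) simp

lemma path_transitions:
  assumes y: "pos_cycles y"
  shows "(\<Prod>n<start y k. trans_prob \<alpha> (alternating y n) (alternating y (Suc n)))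
       = (\<Prod>j<k. pmf (cycle_pmf \<alpha>) (y j))"
proof (induction k)
  case (Suc k)
  let ?T = "\<lambda>n. trans_prob \<alpha> (alternating y n) (alternating y (Suc n))"
  have pos: "0 < fst (y k)" "0 < snd (y k)" using y by (auto simp: pos_cycles_def)
  have idx: "idx 1 = 2" "idx (- 1) = 1" by (auto simp: idx_def a_def)
  have "(\<Prod>n<start y (Suc k). ?T n)
      = (\<Prod>n<start y k. ?T n) * (\<Prod>i<fst (y k). ?T (start y k + i))
        * (\<Prod>i<snd (y k). ?T (start y k + fst (y k) + i))"
    by (simp add: cyc_len_def add.assoc[symmetric] prod_lessThan_add)
  also have "(\<Prod>i<fst (y k). ?T (start y k + i)) = sojourn_prob \<alpha> 2 (fst (y k))"
    using sojourn_transitions[of "fst (y k)" "\<lambda>i. alternating y (start y k + i)" 1 "- 1" \<alpha>]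
      alternating_up[OF y, of _ k] alternating_down[OF y, of 0 k] pos idx by simp
  also have "(\<Prod>i<snd (y k). ?T (start y k + fst (y k) + i)) = sojourn_prob \<alpha> 1 (snd (y k))"
    using sojourn_transitions[of "snd (y k)" "\<lambda>i. alternating y (start y k + fst (y k) + i)" "- 1" 1 \<alpha>]
      alternating_down[OF y, of _ k] alternating_start[OF y, of "Suc k"] pos idx
    by (simp add: cyc_len_def add.assoc)
  finally show ?case using Suc by (simp add: pmf_cycle mult.assoc)
qed simp

text \<open>The transition probabilities along the path group into one factor per sojourn. This is where
  the cycles become independent.\<close>

lemma path_prob:
  assumes y: "pos_cycles y"
  shows "prob {\<omega> \<in> space P. \<forall>n\<le>start y k. (X n \<omega>, M n \<omega>) = alternating y n}
       = (\<Prod>j<k. pmf (cycle_pmf \<alpha>) (y j))"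
proof -
  have "prob {\<omega> \<in> space P. (X 0 \<omega>, M 0 \<omega>) = alternating y 0} = 1"
  proof (subst prob_Collect_eq_1)
    show "{\<omega> \<in> space P. (X 0 \<omega>, M 0 \<omega>) = alternating y 0} \<in> events" by measurable
    show "AE \<omega> in P. (X 0 \<omega>, M 0 \<omega>) = alternating y 0"
      using init alternating_start[OF y, of 0] by simp
  qed
  then show ?thesis
    using markov_chain_path_prob[OF markov, of "alternating y" "start y k", OF alternating_in_states]
    by (simp add: path_transitions[OF y])
qed

lemma run_measurable:
  assumes [measurable]: "s \<in> measurable P (count_space UNIV)"
  shows "(\<lambda>\<omega>. run (\<lambda>n. X n \<omega>) c (s \<omega>)) \<in> measurable P (count_space UNIV)"
proof -
  have [measurable]: "(\<lambda>\<omega>. X (s \<omega> + Suc i) \<omega>) \<in> measurable P (count_space UNIV)" for i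
    by (rule measurable_compose_countable[where g=s]) measurable
  show ?thesis unfolding run_def by measurable
qed

lemma cyc_start_measurable [measurable]:
  "(\<lambda>\<omega>. cyc_start (\<lambda>n. X n \<omega>) j) \<in> measurable P (count_space UNIV)"
proof (induction j)
  case (Suc j)
  note [measurable] = Suc run_measurable
  show ?case by simp
qed simp

definition Y :: "nat \<Rightarrow> 'w \<Rightarrow> nat \<times> nat" where
  "Y j \<omega> = cyc (\<lambda>n. X n \<omega>) j"

lemma Y_measurable [measurable]: "Y j \<in> measurable P (count_space UNIV)"
  unfolding Y_def cyc_def using run_measurable by measurable

text \<open>Beyond \<open>k\<close> the sequence continues with an arbitrary well-formed cycle, so that it drives an
  alternating path.\<close>

definition cycles_upto :: "nat \<Rightarrow> 'w \<Rightarrow> nat \<Rightarrow> nat \<times> nat" where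
  "cycles_upto k \<omega> = (\<lambda>j. if j < k then Y j \<omega> else (1, 1))"

lemma cycles_upto_measurable: "cycles_upto k \<in> measurable P (count_space UNIV)"
proof -
  let ?R = "PiE_dflt {..<k} (1, 1) (\<lambda>_. UNIV :: (nat \<times> nat) set)"
  have "countable ?R"
    unfolding dflt_image_PiE[symmetric] by (intro countable_image countable_PiE) auto
  moreover have "cycles_upto k \<in> space P \<rightarrow> ?R"
    by (auto simp: cycles_upto_def PiE_dflt_def)
  moreover have "cycles_upto k -` {y} \<inter> space P \<in> sets P" if "y \<in> ?R" for y
  proof -
    have "cycles_upto k -` {y} \<inter> space P = {\<omega> \<in> space P. \<forall>j<k. Y j \<omega> = y j}"
      using that by (auto simp: cycles_upto_def PiE_dflt_def fun_eq_iff)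
    also have "\<dots> \<in> sets P" by measurable
    finally show ?thesis .
  qed
  ultimately have "cycles_upto k \<in> measurable P (count_space ?R)"
    by (subst measurable_count_space_eq_countable) blast+
  then show ?thesis
    using measurable_compose[of "cycles_upto k" P "count_space ?R" "\<lambda>y. y" "count_space UNIV"] by simp
qed

lemma pos_cycles_support:
  assumes "y \<in> set_pmf (Pi_pmf {..<k} (1, 1) (\<lambda>_. cycle_pmf \<alpha>))"
  shows "pos_cycles y" and "j \<ge> k \<Longrightarrow> y j = (1, 1)"
proof -
  have y: "y \<in> PiE_dflt {..<k} (1, 1) (\<lambda>_. set_pmf (cycle_pmf \<alpha>))"
    using assms by (simp add: set_Pi_pmf comp_def)
  then show out: "y j = (1, 1)" if "j \<ge> k" for j
    using that by (auto simp: PiE_dflt_def)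
  have "0 < fst (y j) \<and> 0 < snd (y j)" for j
  proof (cases "j < k")
    case True
    then have "y j \<in> set_pmf (cycle_pmf \<alpha>)" using y by (auto simp: PiE_dflt_def)
    then show ?thesis
      using up.sojourn_pos down.sojourn_pos by (cases "y j") (auto simp: cycle_pmf_def)
  qed (simp add: out)
  then show "pos_cycles y" by (simp add: pos_cycles_def)
qed

lemma cycles_upto_of_path:
  assumes y: "pos_cycles y" "\<And>j. j \<ge> k \<Longrightarrow> y j = (1, 1)"
    and path: "\<forall>n\<le>start y k. (X n \<omega>, M n \<omega>) = alternating y n"
  shows "cycles_upto k \<omega> = y"
proof
  fix j
  have "X n \<omega> = fst (alternating y n)" if "n \<le> start y k" for n
    using path that by (metis fst_conv)
  then have "j < k \<Longrightarrow> Y j \<omega> = y j"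
    unfolding Y_def by (rule cyc_of_alternating(2)[OF y(1)])
  then show "cycles_upto k \<omega> j = y j" using y(2) by (simp add: cycles_upto_def)
qed

text \<open>Following the path driven by \<open>y\<close> forces the cycles to be those of \<open>y\<close>. This inclusion only
  bounds the atoms of the law from below, which is enough.\<close>

lemma cycles_upto_law:
  "distr P (count_space UNIV) (cycles_upto k) = measure_pmf (Pi_pmf {..<k} (1, 1) (\<lambda>_. cycle_pmf \<alpha>))"
    (is "_ = measure_pmf ?Q")
proof (rule prob_eq_measure_pmf)
  show "prob_space (distr P (count_space UNIV) (cycles_upto k))"
    by (rule prob_space_distr) (rule cycles_upto_measurable)
  fix y
  show "pmf ?Q y \<le> measure (distr P (count_space UNIV) (cycles_upto k)) {y}"
  proof (cases "y \<in> set_pmf ?Q")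
    case True
    note y = pos_cycles_support[OF True]
    have "pmf ?Q y = prob {\<omega> \<in> space P. \<forall>n\<le>start y k. (X n \<omega>, M n \<omega>) = alternating y n}"
      using y(2) by (subst pmf_Pi) (auto simp: path_prob[OF y(1)] simp del: One_nat_def)
    also have "\<dots> \<le> prob (cycles_upto k -` {y} \<inter> space P)"
      using measurable_sets[OF cycles_upto_measurable, of "{y}" k] cycles_upto_of_path[of y k, OF y]
      by (intro finite_measure_mono) auto
    also have "\<dots> = measure (distr P (count_space UNIV) (cycles_upto k)) {y}"
      by (subst measure_distr) (auto intro: cycles_upto_measurable)
    finally show ?thesis .
  qed (simp add: set_pmf_iff)
qed simp

lemma Y_indep: "indep_vars (\<lambda>_. count_space UNIV) Y UNIV"
  and Y_law: "distr P (count_space UNIV) (Y j) = measure_pmf (cycle_pmf \<alpha>)"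
proof -
  have eq: "cycles_upto k = (\<lambda>\<omega> j. if j < k then Y j \<omega> else (1, 1))" for k
    by (intro ext) (simp add: cycles_upto_def)
  have law: "distr P (count_space UNIV) (\<lambda>\<omega> j. if j < k then Y j \<omega> else (1, 1))
      = measure_pmf (Pi_pmf {..<k} (1, 1) (\<lambda>_. cycle_pmf \<alpha>))" for k
    using cycles_upto_law[of k] unfolding eq[of k] .
  have meas: "(\<lambda>\<omega> j. if j < k then Y j \<omega> else (1, 1)) \<in> measurable P (count_space UNIV)" for k
    using cycles_upto_measurable[of k] unfolding eq[of k] .
  show "indep_vars (\<lambda>_. count_space UNIV) Y UNIV"
    using Y_measurable law meas by (rule indep_vars_count_spaceI(1))
  show "distr P (count_space UNIV) (Y j) = measure_pmf (cycle_pmf \<alpha>)"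
    using Y_measurable law meas by (rule indep_vars_count_spaceI(2))
qed

text \<open>The event that the cycles are those of \<open>y\<close> contains the event that the path driven by \<open>y\<close> is
  followed, and both have the same probability. They differ by a null set, and there are only
  countably many \<open>y\<close> to consider.\<close>

lemma trajectory: "AE \<omega> in P. \<forall>n. X n \<omega> = fst (alternating (\<lambda>j. Y j \<omega>) n)"
proof -
  have "AE \<omega> in P. \<forall>n\<le>start (\<lambda>j. Y j \<omega>) k. X n \<omega> = fst (alternating (\<lambda>j. Y j \<omega>) n)" for k
  proof -
    let ?Q = "Pi_pmf {..<k} (1, 1) (\<lambda>_. cycle_pmf \<alpha>)"
    have "AE y in measure_pmf ?Q. y \<in> set_pmf ?Q"
      by (rule AE_measure_pmf)
    then have "AE y in distr P (count_space UNIV) (cycles_upto k). y \<in> set_pmf ?Q"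
      by (simp only: cycles_upto_law)
    then have 1: "AE \<omega> in P. cycles_upto k \<omega> \<in> set_pmf ?Q"
      by (rule AE_distrD[OF cycles_upto_measurable])
    have "AE \<omega> in P. \<forall>y\<in>set_pmf ?Q. cycles_upto k \<omega> = y \<longrightarrow>
            (\<forall>n\<le>start y k. (X n \<omega>, M n \<omega>) = alternating y n)"
    proof (subst AE_ball_countable, simp, intro ballI)
      fix y assume yQ: "y \<in> set_pmf ?Q"
      note y = pos_cycles_support[OF yQ]
      let ?A = "cycles_upto k -` {y} \<inter> space P"
      let ?E = "{\<omega> \<in> space P. \<forall>n\<le>start y k. (X n \<omega>, M n \<omega>) = alternating y n}"
      have A: "?A \<in> sets P" using measurable_sets[OF cycles_upto_measurable, of "{y}" k] by simp
      have E: "?E \<in> sets P" by measurable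
      have "prob ?A = measure (distr P (count_space UNIV) (cycles_upto k)) {y}"
        by (subst measure_distr) (auto intro: cycles_upto_measurable)
      also have "\<dots> = (\<Prod>j<k. pmf (cycle_pmf \<alpha>) (y j))"
        unfolding cycles_upto_law using y(2) by (subst measure_pmf_single) (subst pmf_Pi, auto)
      also have "\<dots> = prob ?E" by (rule path_prob[OF y(1), symmetric])
      finally have "prob (?A - ?E) = 0"
        using cycles_upto_of_path[of y k, OF y] by (subst finite_measure_Diff[OF A E]) auto
      then have "AE \<omega> in P. \<omega> \<notin> ?A - ?E" using A E by (subst (asm) prob_eq_0) auto
      then show "AE \<omega> in P. cycles_upto k \<omega> = y \<longrightarrow> (\<forall>n\<le>start y k. (X n \<omega>, M n \<omega>) = alternating y n)"
        using AE_space by eventually_elim auto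
    qed
    with 1 show ?thesis
    proof eventually_elim
      case (elim \<omega>)
      let ?y = "cycles_upto k \<omega>" and ?Y = "\<lambda>j. Y j \<omega>"
      have pos: "pos_cycles ?Y" unfolding Y_def by (rule pos_cycles_cyc)
      have "pos_cycles ?y" using pos_cycles_support(1) elim(1) by blast
      have eq: "?y j = ?Y j" if "j < k" for j using that by (simp add: cycles_upto_def)
      have st: "start ?Y k = start ?y k" by (rule start_cong) (simp add: eq)
      show ?case
      proof (intro allI impI)
        fix n assume n: "n \<le> start ?Y k"
        have "alternating ?y n = alternating ?Y n"
          using n st eq by (intro alternating_cong[where k=k]) (auto simp: pos \<open>pos_cycles ?y\<close>)
        moreover have "(X n \<omega>, M n \<omega>) = alternating ?y n" using elim n st by auto
        ultimately show "X n \<omega> = fst (alternating ?Y n)" by (metis fst_conv)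
      qed
    qed
  qed
  then have "AE \<omega> in P. \<forall>k. \<forall>n\<le>start (\<lambda>j. Y j \<omega>) k. X n \<omega> = fst (alternating (\<lambda>j. Y j \<omega>) n)"
    by (simp add: AE_all_countable)
  then show ?thesis
  proof eventually_elim
    case (elim \<omega>)
    have "n \<le> start (\<lambda>j. Y j \<omega>) n" for n
      by (rule renewal_ge) (rule pos_cyc_len, simp add: Y_def pos_cycles_cyc)
    then show ?case using elim by blast
  qed
qed

end

section \<open>Weak convergence under vanishing perturbations\<close>

text \<open>Convergence to zero in probability, expressed through the metric of that convergence. In this form
  almost sure and mean square convergence both imply it directly.\<close>

definition (in prob_space) vanishes_in_prob :: "(nat \<Rightarrow> 'a \<Rightarrow> real) \<Rightarrow> bool" where
  "vanishes_in_prob U \<longleftrightarrow> (\<forall>n. U n \<in> borel_measurable M) \<and>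
     (\<lambda>n. expectation (\<lambda>\<omega>. min 1 \<bar>U n \<omega>\<bar>)) \<longlonglongrightarrow> 0"

context prob_space
begin

lemma integrable_min_1:
  fixes f :: "'a \<Rightarrow> real"
  assumes [measurable]: "f \<in> borel_measurable M"
  shows "integrable M (\<lambda>\<omega>. min 1 \<bar>f \<omega>\<bar>)"
  by (rule integrable_const_bound[where B=1]) auto

lemma vanishes_in_prob_add:
  assumes "vanishes_in_prob U" "vanishes_in_prob V"
  shows "vanishes_in_prob (\<lambda>n \<omega>. U n \<omega> + V n \<omega>)"
proof -
  have [measurable]: "U n \<in> borel_measurable M" "V n \<in> borel_measurable M" for n
    using assms by (auto simp: vanishes_in_prob_def)
  let ?E = "\<lambda>U n. expectation (\<lambda>\<omega>. min 1 \<bar>U n \<omega>\<bar>)"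
  have "(\<lambda>n. ?E U n + ?E V n) \<longlonglongrightarrow> 0 + 0"
    using assms by (intro tendsto_add) (auto simp: vanishes_in_prob_def)
  then have lim: "(\<lambda>n. ?E U n + ?E V n) \<longlonglongrightarrow> 0" by simp
  have "?E (\<lambda>n \<omega>. U n \<omega> + V n \<omega>) n \<le> ?E U n + ?E V n" for n
  proof -
    have "?E (\<lambda>n \<omega>. U n \<omega> + V n \<omega>) n \<le> expectation (\<lambda>\<omega>. min 1 \<bar>U n \<omega>\<bar> + min 1 \<bar>V n \<omega>\<bar>)"
    proof (rule integral_mono)
      show "min 1 \<bar>U n \<omega> + V n \<omega>\<bar> \<le> min 1 \<bar>U n \<omega>\<bar> + min 1 \<bar>V n \<omega>\<bar>" for \<omega>
        by linarith
    qed (intro integrable_min_1 Bochner_Integration.integrable_add; measurable)+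
    also have "\<dots> = ?E U n + ?E V n"
      by (intro Bochner_Integration.integral_add integrable_min_1) auto
    finally show ?thesis .
  qed
  then have "(\<lambda>n. ?E (\<lambda>n \<omega>. U n \<omega> + V n \<omega>) n) \<longlonglongrightarrow> 0"
    by - (rule tendsto_sandwich[OF always_eventually always_eventually tendsto_const lim], auto)
  then show ?thesis by (simp add: vanishes_in_prob_def)
qed

lemma vanishes_in_prob_AE:
  assumes [measurable]: "\<And>n. U n \<in> borel_measurable M" and "AE \<omega> in M. (\<lambda>n. U n \<omega>) \<longlonglongrightarrow> 0"
  shows "vanishes_in_prob U"
proof -
  have "(\<lambda>n. expectation (\<lambda>\<omega>. min 1 \<bar>U n \<omega>\<bar>)) \<longlonglongrightarrow> expectation (\<lambda>_. 0)"
  proof (rule integral_dominated_convergence[where w="\<lambda>_. 1"])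
    show "AE \<omega> in M. (\<lambda>n. min 1 \<bar>U n \<omega>\<bar>) \<longlonglongrightarrow> 0"
      using assms(2)
    proof eventually_elim
      case (elim \<omega>)
      have "(\<lambda>n. min 1 \<bar>U n \<omega>\<bar>) \<longlonglongrightarrow> min 1 \<bar>0\<bar>" by (intro tendsto_intros elim)
      then show ?case by simp
    qed
  qed auto
  then show ?thesis by (simp add: vanishes_in_prob_def)
qed

lemma vanishes_in_prob_L2:
  assumes [measurable]: "\<And>n. U n \<in> borel_measurable M" and sq: "\<And>n. integrable M (\<lambda>\<omega>. (U n \<omega>)\<^sup>2)"
    and lim: "(\<lambda>n. expectation (\<lambda>\<omega>. (U n \<omega>)\<^sup>2)) \<longlonglongrightarrow> 0"
  shows "vanishes_in_prob U"
proof -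
  have "expectation (\<lambda>\<omega>. min 1 \<bar>U n \<omega>\<bar>) \<le> sqrt (expectation (\<lambda>\<omega>. (U n \<omega>)\<^sup>2))" for n
  proof -
    have int: "integrable M (\<lambda>\<omega>. \<bar>U n \<omega>\<bar>)"
      by (rule integrable_abs, rule square_integrable_imp_integrable) (simp_all add: sq)
    have "expectation (\<lambda>\<omega>. min 1 \<bar>U n \<omega>\<bar>) \<le> expectation (\<lambda>\<omega>. \<bar>U n \<omega>\<bar>)"
      by (intro integral_mono integrable_min_1 int) auto
    also have "\<dots> \<le> sqrt (expectation (\<lambda>\<omega>. (U n \<omega>)\<^sup>2))"
    proof (rule real_le_rsqrt)
      have "0 \<le> variance (\<lambda>\<omega>. \<bar>U n \<omega>\<bar>)" by (rule variance_positive)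
      also have "\<dots> = expectation (\<lambda>\<omega>. (U n \<omega>)\<^sup>2) - (expectation (\<lambda>\<omega>. \<bar>U n \<omega>\<bar>))\<^sup>2"
        using int sq by (subst variance_eq) auto
      finally show "(expectation (\<lambda>\<omega>. \<bar>U n \<omega>\<bar>))\<^sup>2 \<le> expectation (\<lambda>\<omega>. (U n \<omega>)\<^sup>2)" by simp
    qed
    finally show ?thesis .
  qed
  moreover have "(\<lambda>n. sqrt (expectation (\<lambda>\<omega>. (U n \<omega>)\<^sup>2))) \<longlonglongrightarrow> 0"
    using tendsto_real_sqrt[OF lim] by simp
  ultimately have "(\<lambda>n. expectation (\<lambda>\<omega>. min 1 \<bar>U n \<omega>\<bar>)) \<longlonglongrightarrow> 0"
    by - (rule tendsto_sandwich[OF always_eventually always_eventually tendsto_const], auto)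
  then show ?thesis by (simp add: vanishes_in_prob_def)
qed

lemma iexp_dist: "cmod (iexp x - iexp y) \<le> \<bar>x - y\<bar>"
proof -
  have "iexp x - iexp y = iexp y * (iexp (x - y) - 1)"
    by (simp add: algebra_simps exp_diff)
  also have "cmod \<dots> = cmod (iexp (x - y) - 1)" by (simp add: norm_mult)
  also have "\<dots> \<le> \<bar>x - y\<bar>" using iexp_approx1[of "x - y" 0] by simp
  finally show ?thesis .
qed

text \<open>The map \<open>x \<mapsto> exp (\<i> * t * x)\<close> is bounded and Lipschitz, hence the characteristic functions differ by
  at most \<open>max 2 \<bar>t\<bar>\<close> times the expectation of \<open>min 1 \<bar>B\<^sub>n - A\<^sub>n\<bar>\<close>, and Levy continuity concludes.\<close>

theorem slutsky:
  assumes A: "\<And>n. A n \<in> borel_measurable M" and B: "\<And>n. B n \<in> borel_measurable M"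
    and conv: "weak_conv_m (\<lambda>n. distr M borel (A n)) \<mu>" and \<mu>: "real_distribution \<mu>"
    and van: "vanishes_in_prob (\<lambda>n \<omega>. B n \<omega> - A n \<omega>)"
  shows "weak_conv_m (\<lambda>n. distr M borel (B n)) \<mu>"
proof (rule levy_continuity)
  note [measurable] = A B
  show "real_distribution (distr M borel (B n))" for n by (rule real_distribution_distr[OF B])
  show "real_distribution \<mu>" by (rule \<mu>)
  fix t
  let ?d = "\<lambda>n. expectation (\<lambda>\<omega>. min 1 \<bar>B n \<omega> - A n \<omega>\<bar>)"
  have charA: "(\<lambda>n. char (distr M borel (A n)) t) \<longlonglongrightarrow> char \<mu> t"
    by (rule levy_continuity1[OF _ \<mu> conv]) (rule real_distribution_distr[OF A])
  have int: "complex_integrable M (\<lambda>\<omega>. iexp (t * f \<omega>))" if [measurable]: "f \<in> borel_measurable M" for f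
    by (rule integrable_iexp) auto
  have bound: "norm (char (distr M borel (B n)) t - char (distr M borel (A n)) t) \<le> max 2 \<bar>t\<bar> * ?d n" for n
  proof -
    have "char (distr M borel (B n)) t - char (distr M borel (A n)) t
        = (CLINT \<omega>|M. iexp (t * B n \<omega>) - iexp (t * A n \<omega>))"
      using int[OF A, of n] int[OF B, of n] by (simp add: char_def integral_distr)
    also have "norm \<dots> \<le> expectation (\<lambda>\<omega>. norm (iexp (t * B n \<omega>) - iexp (t * A n \<omega>)))"
      by (rule integral_norm_bound)
    also have "\<dots> \<le> expectation (\<lambda>\<omega>. max 2 \<bar>t\<bar> * min 1 \<bar>B n \<omega> - A n \<omega>\<bar>)"
    proof (rule integral_mono)
      show "integrable M (\<lambda>\<omega>. norm (iexp (t * B n \<omega>) - iexp (t * A n \<omega>)))"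
        by (intro integrable_norm Bochner_Integration.integrable_diff int A B)
      show "integrable M (\<lambda>\<omega>. max 2 \<bar>t\<bar> * min 1 \<bar>B n \<omega> - A n \<omega>\<bar>)"
        by (intro integrable_mult_right integrable_min_1) measurable
      fix \<omega>
      let ?D = "norm (iexp (t * B n \<omega>) - iexp (t * A n \<omega>))"
      have 1: "?D \<le> \<bar>t\<bar> * \<bar>B n \<omega> - A n \<omega>\<bar>"
        using iexp_dist[of "t * B n \<omega>" "t * A n \<omega>"] by (simp add: abs_mult[symmetric] algebra_simps)
      have 2: "?D \<le> 2"
        using norm_triangle_ineq4[of "iexp (t * B n \<omega>)" "iexp (t * A n \<omega>)"] by (simp del: of_real_mult)
      show "?D \<le> max 2 \<bar>t\<bar> * min 1 \<bar>B n \<omega> - A n \<omega>\<bar>"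
      proof (cases "\<bar>B n \<omega> - A n \<omega>\<bar> \<le> 1")
        case True
        have "\<bar>t\<bar> * \<bar>B n \<omega> - A n \<omega>\<bar> \<le> max 2 \<bar>t\<bar> * \<bar>B n \<omega> - A n \<omega>\<bar>" by (rule mult_right_mono) auto
        then show ?thesis using True 1 by (simp add: min_def)
      next
        case False
        then show ?thesis using 2 by (simp add: min_def)
      qed
    qed
    finally show ?thesis by simp
  qed
  have "(\<lambda>n. max 2 \<bar>t\<bar> * ?d n) \<longlonglongrightarrow> max 2 \<bar>t\<bar> * 0"
    using van by (intro tendsto_mult tendsto_const) (simp add: vanishes_in_prob_def)
  then have "(\<lambda>n. max 2 \<bar>t\<bar> * ?d n) \<longlonglongrightarrow> 0" by simp
  then have "(\<lambda>n. char (distr M borel (B n)) t - char (distr M borel (A n)) t) \<longlonglongrightarrow> 0"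
    by (rule Lim_null_comparison[rotated]) (auto intro!: always_eventually bound)
  from tendsto_add[OF this charA]
  show "(\<lambda>n. char (distr M borel (B n)) t) \<longlonglongrightarrow> char \<mu> t" by simp
qed

end

lemma weak_conv_m_subseq:
  assumes "weak_conv_m F G" "filterlim r at_top sequentially"
  shows "weak_conv_m (\<lambda>n. F (r n)) G"
  unfolding weak_conv_m_def weak_conv_def
proof (intro allI impI)
  fix x assume "isCont (cdf G) x"
  then have "(\<lambda>n. cdf (F n) x) \<longlonglongrightarrow> cdf G x"
    using assms(1) by (simp add: weak_conv_m_def weak_conv_def)
  then show "(\<lambda>n. cdf (F (r n)) x) \<longlonglongrightarrow> cdf G x"
    by (rule filterlim_compose[OF _ assms(2)])
qed

section \<open>The number of cycles per unit of time\<close>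

text \<open>The \<open>n\<close>-th summand is the difference of two consecutive sums, whose averages share a limit.\<close>

lemma averages_imp_terms_vanish:
  fixes f :: "nat \<Rightarrow> real"
  assumes "(\<lambda>n. (\<Sum>i<n. f i) / real n) \<longlonglongrightarrow> c"
  shows "(\<lambda>n. f n / real n) \<longlonglongrightarrow> 0"
proof -
  have "(\<lambda>n. (\<Sum>i<Suc n. f i) / real (Suc n)) \<longlonglongrightarrow> c"
    using assms by (rule LIMSEQ_Suc)
  moreover have "(\<lambda>n. 1 + 1 / real n) \<longlonglongrightarrow> 1 + 0"
    by (intro tendsto_add tendsto_const lim_1_over_n)
  ultimately have "(\<lambda>n. (\<Sum>i<Suc n. f i) / real (Suc n) * (1 + 1 / real n) - (\<Sum>i<n. f i) / real n)
      \<longlonglongrightarrow> c * (1 + 0) - c"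
    by (intro tendsto_diff tendsto_mult assms)
  then have "(\<lambda>n. (\<Sum>i<Suc n. f i) / real (Suc n) * (1 + 1 / real n) - (\<Sum>i<n. f i) / real n) \<longlonglongrightarrow> 0"
    by simp
  moreover have "eventually (\<lambda>n. (\<Sum>i<Suc n. f i) / real (Suc n) * (1 + 1 / real n) - (\<Sum>i<n. f i) / real n
      = f n / real n) sequentially"
    using eventually_gt_at_top[of 0] 
  proof eventually_elim
    case (elim n)
    then have n: "1 + 1 / real n = real (Suc n) / real n" by (simp add: field_simps)
    have "(\<Sum>i<Suc n. f i) / real (Suc n) * (1 + 1 / real n) = (\<Sum>i<Suc n. f i) / real n"
      unfolding n by (simp del: of_nat_Suc sum.lessThan_Suc)
    then show ?case by (simp add: add_divide_distrib del: of_nat_Suc)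
  qed
  ultimately show ?thesis by (rule Lim_transform_eventually)
qed

lemma cycle_of_at_top:
  assumes "\<And>j. 0 < l j"
  shows "filterlim (cycle_of l) at_top sequentially"
  unfolding filterlim_at_top
proof
  fix j
  show "eventually (\<lambda>n. j \<le> cycle_of l n) sequentially"
    using eventually_ge_at_top[of "renewal l j"]
    by eventually_elim (use renewal_le_iff[of l j, OF assms] in simp)
qed

text \<open>With \<open>N\<close> complete cycles, time \<open>n\<close> lies between the sums of the first \<open>N\<close> and \<open>N + 1\<close> lengths. Dividing
  by \<open>N\<close> squeezes \<open>n / N\<close> to the mean length.\<close>

lemma cycle_count_over_time:
  assumes pos: "\<And>j. 0 < l j" and lim: "(\<lambda>k. (\<Sum>j<k. real (l j)) / real k) \<longlonglongrightarrow> m" and m: "0 < m"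
  shows "(\<lambda>n. real (cycle_of l n) / real n) \<longlonglongrightarrow> 1 / m"
proof -
  let ?N = "cycle_of l" and ?T = "\<lambda>k. (\<Sum>j<k. real (l j)) / real k"
  have top: "filterlim ?N at_top sequentially" using pos by (rule cycle_of_at_top)
  have T: "(\<Sum>j<k. real (l j)) = real (renewal l k)" for k by (simp add: renewal_def)
  have low: "(\<lambda>n. ?T (?N n)) \<longlonglongrightarrow> m" by (rule filterlim_compose[OF lim top])
  have "(\<lambda>k. ?T k + real (l k) / real k) \<longlonglongrightarrow> m + 0"
    by (rule tendsto_add[OF lim averages_imp_terms_vanish[OF lim]])
  then have high: "(\<lambda>n. ?T (?N n) + real (l (?N n)) / real (?N n)) \<longlonglongrightarrow> m"
    using filterlim_compose[OF _ top, of "\<lambda>k. ?T k + real (l k) / real k"] by simp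
  have ev: "eventually (\<lambda>n. ?N n > 0) sequentially"
    using eventually_gt_at_top[of 0] top by (rule eventually_compose_filterlim)
  have "(\<lambda>n. real n / real (?N n)) \<longlonglongrightarrow> m"
  proof (rule tendsto_sandwich[OF _ _ low high])
    show "eventually (\<lambda>n. ?T (?N n) \<le> real n / real (?N n)) sequentially"
      unfolding T using cycle_of_bounds(1)[of l, OF pos]
      by (intro always_eventually allI divide_right_mono) auto
    show "eventually (\<lambda>n. real n / real (?N n) \<le> ?T (?N n) + real (l (?N n)) / real (?N n)) sequentially"
    proof (intro always_eventually allI)
      fix n
      have "real n \<le> real (renewal l (?N n)) + real (l (?N n))"
        using cycle_of_bounds(2)[of l n, OF pos] by simp
      then show "real n / real (?N n) \<le> ?T (?N n) + real (l (?N n)) / real (?N n)"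
        unfolding T add_divide_distrib[symmetric] by (rule divide_right_mono) simp
    qed
  qed
  then have "(\<lambda>n. 1 / (real n / real (?N n))) \<longlonglongrightarrow> 1 / m"
    using m by (intro tendsto_divide tendsto_const) auto
  then show ?thesis by simp
qed

section \<open>The law of large numbers for renewal reward processes\<close>

text \<open>A process \<open>C\<close> collects the reward of every complete cycle and differs from their sum by at most the
  length of the cycle in progress.\<close>

locale renewal_reward = prob_space P
  for P :: "'w measure"
    and Y :: "nat \<Rightarrow> 'w \<Rightarrow> 'c"
    and D :: "'c pmf"
    and len :: "'c \<Rightarrow> nat"
    and rew :: "'c \<Rightarrow> real"
    and C :: "nat \<Rightarrow> 'w \<Rightarrow> real" +
  assumes indep: "indep_vars (\<lambda>_. count_space UNIV) Y UNIV"
    and law: "\<And>j. distr P (count_space UNIV) (Y j) = measure_pmf D"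
    and len_pos: "\<And>j \<omega>. 0 < len (Y j \<omega>)"
    and len_integrable: "integrable (measure_pmf D) (\<lambda>c. real (len c))"
    and rew_le: "\<And>c. \<bar>rew c\<bar> \<le> real (len c)"
    and C_measurable [measurable]: "\<And>n. C n \<in> borel_measurable P"
    and C_close: "AE \<omega> in P. \<forall>n.
        \<bar>C n \<omega> - (\<Sum>j<cycle_of (\<lambda>j. len (Y j \<omega>)) n. rew (Y j \<omega>))\<bar>
          \<le> real (len (Y (cycle_of (\<lambda>j. len (Y j \<omega>)) n) \<omega>))"
begin

lemma Y_measurable [measurable]: "Y j \<in> measurable P (count_space UNIV)"
  using indep by (simp add: indep_vars_def)

lemma Y_compose_measurable [measurable]: "(\<lambda>\<omega>. h (Y j \<omega>)) \<in> borel_measurable P"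
  by (rule measurable_compose[OF Y_measurable]) simp

lemma Y_integrable_iff:
  fixes h :: "'c \<Rightarrow> real"
  shows "integrable P (\<lambda>\<omega>. h (Y j \<omega>)) \<longleftrightarrow> integrable (measure_pmf D) h"
  unfolding law[of j, symmetric] by (subst integrable_distr_eq) auto

lemma Y_expectation:
  fixes h :: "'c \<Rightarrow> real"
  shows "expectation (\<lambda>\<omega>. h (Y j \<omega>)) = measure_pmf.expectation D h"
  unfolding law[of j, symmetric] by (subst integral_distr) auto

lemma Y_distr:
  fixes h :: "'c \<Rightarrow> real"
  shows "distr P borel (\<lambda>\<omega>. h (Y j \<omega>)) = distr (measure_pmf D) borel h"
  unfolding law[of j, symmetric] by (subst distr_distr) (auto simp: comp_def)

lemma Y_compose_indep:
  fixes h :: "'c \<Rightarrow> real"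
  shows "indep_vars (\<lambda>_. borel) (\<lambda>j \<omega>. h (Y j \<omega>)) UNIV"
  by (rule indep_vars_compose2[OF indep]) simp

lemma Y_averages:
  fixes h :: "'c \<Rightarrow> real"
  assumes "integrable (measure_pmf D) h"
  shows "AE \<omega> in P. (\<lambda>n. (\<Sum>j<n. h (Y j \<omega>)) / real n) \<longlonglongrightarrow> measure_pmf.expectation D h"
  using strong_law_of_large_numbers[OF Y_compose_indep, of h] assms
  by (simp add: Y_distr Y_integrable_iff Y_expectation)

definition mean_len :: real where "mean_len = measure_pmf.expectation D (\<lambda>c. real (len c))"
definition mean_rew :: real where "mean_rew = measure_pmf.expectation D rew"

definition N :: "nat \<Rightarrow> 'w \<Rightarrow> nat" where "N n \<omega> = cycle_of (\<lambda>j. len (Y j \<omega>)) n"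

lemma N_measurable [measurable]: "N n \<in> measurable P (count_space UNIV)"
proof -
  have [measurable]: "(\<lambda>\<omega>. real (renewal (\<lambda>j. len (Y j \<omega>)) k)) \<in> borel_measurable P" for k
    unfolding renewal_def by simp
  have "(\<lambda>\<omega>. LEAST k. real n < real (renewal (\<lambda>j. len (Y j \<omega>)) (Suc k))) \<in> measurable P (count_space UNIV)"
    by (intro measurable_Least) measurable
  also have "(\<lambda>\<omega>. LEAST k. real n < real (renewal (\<lambda>j. len (Y j \<omega>)) (Suc k))) = N n"
    by (intro ext) (simp only: N_def cycle_of_def of_nat_less_iff)
  finally show ?thesis .
qed

lemma N_le: "N n \<omega> \<le> n"
  unfolding N_def using len_pos by (intro cycle_of_le) auto

lemma N_at_top: "filterlim (\<lambda>n. N n \<omega>) at_top sequentially"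
  unfolding N_def using len_pos by (intro cycle_of_at_top) auto

lemma mean_len_ge_1: "1 \<le> mean_len"
proof -
  have "expectation (\<lambda>_. 1) \<le> expectation (\<lambda>\<omega>. real (len (Y 0 \<omega>)))"
    using len_integrable len_pos[of 0]
    by (intro integral_mono) (auto simp: Y_integrable_iff[where h="\<lambda>c. real (len c)"] Suc_le_eq)
  then show ?thesis
    by (simp add: Y_expectation[where h="\<lambda>c. real (len c)"] mean_len_def prob_space)
qed

lemma N_over_n: "AE \<omega> in P. (\<lambda>n. real (N n \<omega>) / real n) \<longlonglongrightarrow> 1 / mean_len"
  using Y_averages[OF len_integrable]
proof eventually_elim
  case (elim \<omega>)
  then show ?case
    unfolding N_def using len_pos mean_len_ge_1 by (intro cycle_count_over_time) (auto simp: mean_len_def)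
qed

lemma rew_integrable: "integrable (measure_pmf D) rew"
  by (rule Bochner_Integration.integrable_bound[OF len_integrable]) (auto simp: rew_le)

text \<open>Reward per time is reward per cycle times cycles per time. The cycle in progress is negligible,
  since its length is a summand of a convergent average.\<close>

theorem renewal_reward_law:
  "AE \<omega> in P. (\<lambda>n. C n \<omega> / real n) \<longlonglongrightarrow> mean_rew / mean_len"
  using N_over_n Y_averages[OF len_integrable] Y_averages[OF rew_integrable] C_close
proof eventually_elim
  case (elim \<omega>)
  let ?N = "\<lambda>n. N n \<omega>" and ?R = "\<lambda>k. \<Sum>j<k. rew (Y j \<omega>)" and ?l = "\<lambda>k. real (len (Y k \<omega>))"
  have lN: "(\<lambda>n. ?l (?N n) / real (?N n) * (real (?N n) / real n)) \<longlonglongrightarrow> 0 * (1 / mean_len)"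
    by (intro tendsto_mult elim(1) filterlim_compose[OF averages_imp_terms_vanish[OF elim(2)] N_at_top])
  have main: "(\<lambda>n. ?R (?N n) / real (?N n) * (real (?N n) / real n)) \<longlonglongrightarrow> mean_rew * (1 / mean_len)"
    unfolding mean_rew_def by (intro tendsto_mult elim(1) filterlim_compose[OF elim(3) N_at_top])
  have ev: "eventually (\<lambda>n. ?N n > 0) sequentially"
    using eventually_gt_at_top[of 0] N_at_top by (rule eventually_compose_filterlim)
  have "(\<lambda>n. C n \<omega> / real n - ?R (?N n) / real (?N n) * (real (?N n) / real n)) \<longlonglongrightarrow> 0"
  proof (rule Lim_null_comparison)
    show "(\<lambda>n. ?l (?N n) / real (?N n) * (real (?N n) / real n)) \<longlonglongrightarrow> 0" using lN by simp
    show "eventually (\<lambda>n. norm (C n \<omega> / real n - ?R (?N n) / real (?N n) * (real (?N n) / real n))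
        \<le> ?l (?N n) / real (?N n) * (real (?N n) / real n)) sequentially"
      using ev
    proof eventually_elim
      case N0: (elim n)
      have "\<bar>(C n \<omega> - ?R (?N n)) / real n\<bar> \<le> ?l (?N n) / real n"
        using elim(4) by (simp add: N_def divide_right_mono)
      then show ?case using N0 by (simp add: diff_divide_distrib)
    qed
  qed
  from tendsto_add[OF this main] show ?case by simp
qed

text \<open>A functional of the cycles before \<open>J\<close> is independent of cycle \<open>J\<close>. The functional is given on whole
  sequences, to which the hypothesis \<open>local\<close> restores it after the restriction to \<open>{..<J}\<close>.\<close>

lemma past_future_product:
  fixes G :: "(nat \<Rightarrow> 'c) \<Rightarrow> real" and h :: "'c \<Rightarrow> real"
  assumes G: "G \<in> borel_measurable (\<Pi>\<^sub>M i\<in>{..<J}. count_space UNIV)"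
    and local: "\<And>f. G (restrict f {..<J}) = G f"
    and iG: "integrable P (\<lambda>\<omega>. G (\<lambda>i. Y i \<omega>))" and ih: "integrable (measure_pmf D) h"
  shows "integrable P (\<lambda>\<omega>. G (\<lambda>i. Y i \<omega>) * h (Y J \<omega>))"
    and "expectation (\<lambda>\<omega>. G (\<lambda>i. Y i \<omega>) * h (Y J \<omega>))
       = expectation (\<lambda>\<omega>. G (\<lambda>i. Y i \<omega>)) * measure_pmf.expectation D h"
proof -
  have "indep_var (PiM {..<J} (\<lambda>_. count_space UNIV)) (\<lambda>\<omega>. restrict (\<lambda>i. Y i \<omega>) {..<J})
      (PiM {J} (\<lambda>_. count_space UNIV)) (\<lambda>\<omega>. restrict (\<lambda>i. Y i \<omega>) {J})"
    by (rule indep_var_restrict[OF indep]) auto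
  then have "indep_var borel (G \<circ> (\<lambda>\<omega>. restrict (\<lambda>i. Y i \<omega>) {..<J}))
      borel ((\<lambda>f. h (f J)) \<circ> (\<lambda>\<omega>. restrict (\<lambda>i. Y i \<omega>) {J}))"
  proof (rule indep_var_compose)
    show "(\<lambda>f. h (f J)) \<in> borel_measurable (PiM {J} (\<lambda>_. count_space UNIV))"
      by (rule measurable_compose[OF measurable_component_singleton]) auto
  qed (rule G)
  then have ind: "indep_var borel (\<lambda>\<omega>. G (\<lambda>i. Y i \<omega>)) borel (\<lambda>\<omega>. h (Y J \<omega>))"
    by (simp add: comp_def local)
  show "integrable P (\<lambda>\<omega>. G (\<lambda>i. Y i \<omega>) * h (Y J \<omega>))"
    using indep_var_integrable[OF ind iG] ih by (simp add: Y_integrable_iff)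
  show "expectation (\<lambda>\<omega>. G (\<lambda>i. Y i \<omega>) * h (Y J \<omega>))
       = expectation (\<lambda>\<omega>. G (\<lambda>i. Y i \<omega>)) * measure_pmf.expectation D h"
    using indep_var_lebesgue_integral[OF ind iG] ih by (simp add: Y_integrable_iff Y_expectation)
qed

text \<open>Multiplying centred independent increments by predictable bounded factors keeps them orthogonal: in
  the square of the sum, every mixed product contains a centred increment that is independent of the
  rest.\<close>

lemma transform_second_moment:
  fixes d :: "nat \<Rightarrow> (nat \<Rightarrow> 'c) \<Rightarrow> real" and h :: "'c \<Rightarrow> real"
  assumes d: "\<And>i. d i \<in> borel_measurable (\<Pi>\<^sub>M i\<in>{..<i}. count_space UNIV)"
    and local: "\<And>i f g. (\<And>j. j < i \<Longrightarrow> f j = g j) \<Longrightarrow> d i f = d i g"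
    and bound: "\<And>i f. \<bar>d i f\<bar> \<le> 1"
    and sq: "integrable (measure_pmf D) (\<lambda>c. (h c)\<^sup>2)" and centred: "measure_pmf.expectation D h = 0"
  defines "Q \<equiv> \<lambda>J f. \<Sum>i<J. h (f i) * d i f"
  shows "integrable P (\<lambda>\<omega>. (Q J (\<lambda>i. Y i \<omega>))\<^sup>2)" (is "?I J")
    and "expectation (\<lambda>\<omega>. (Q J (\<lambda>i. Y i \<omega>))\<^sup>2)
       = measure_pmf.expectation D (\<lambda>c. (h c)\<^sup>2) * expectation (\<lambda>\<omega>. \<Sum>i<J. (d i (\<lambda>i. Y i \<omega>))\<^sup>2)"
      (is "?E J")
proof -
  let ?\<Pi> = "\<lambda>J :: nat. \<Pi>\<^sub>M i\<in>{..<J}. count_space (UNIV :: 'c set)"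
  have h_int: "integrable (measure_pmf D) h"
    by (rule measure_pmf.square_integrable_imp_integrable) (auto intro: sq)
  have comp: "(\<lambda>f. restrict f {..<i}) \<in> measurable (?\<Pi> J) (?\<Pi> i)" if "i \<le> J" for i J :: nat
    using that by (intro measurable_restrict_subset) auto
  have d_meas: "(\<lambda>f. d i f) \<in> borel_measurable (?\<Pi> J)" if "i \<le> J" for i J :: nat
  proof -
    have "(\<lambda>f. d i (restrict f {..<i})) \<in> borel_measurable (?\<Pi> J)"
      by (rule measurable_compose[OF comp[OF that] d])
    also have "(\<lambda>f. d i (restrict f {..<i})) = (\<lambda>f. d i f)"
      by (intro ext local) auto
    finally show ?thesis .
  qed
  have h_meas: "(\<lambda>f. h (f i)) \<in> borel_measurable (?\<Pi> J)" if "i < J" for i J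
    by (rule measurable_compose[OF measurable_component_singleton]) (use that in auto)
  have Q_meas: "Q J \<in> borel_measurable (?\<Pi> J)" for J
    unfolding Q_def by (intro borel_measurable_sum borel_measurable_times h_meas d_meas) auto
  have Y_vec: "(\<lambda>\<omega>. \<lambda>i\<in>{..<J}. Y i \<omega>) \<in> measurable P (?\<Pi> J)" for J
    by (rule measurable_restrict) simp
  have d_restrict: "d i (restrict f {..<J}) = d i f" if "i \<le> J" for i J f
    by (rule local) (use that in auto)
  have Q_restrict: "Q J (restrict f {..<J}) = Q J f" for J f
    unfolding Q_def by (intro sum.cong) (auto simp: d_restrict)
  have dY [measurable]: "(\<lambda>\<omega>. d i (\<lambda>i. Y i \<omega>)) \<in> borel_measurable P" for i
    using measurable_compose[OF Y_vec d, of i] by (simp add: d_restrict)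
  have QY [measurable]: "(\<lambda>\<omega>. Q J (\<lambda>i. Y i \<omega>)) \<in> borel_measurable P" for J
    using measurable_compose[OF Y_vec Q_meas, of J] by (simp add: Q_restrict)
  have d2: "integrable P (\<lambda>\<omega>. (d i (\<lambda>i. Y i \<omega>))\<^sup>2)" for i
    by (rule integrable_const_bound[where B=1]) (auto simp: bound abs_square_le_1)
  have "?I J \<and> ?E J" for J
  proof (induction J)
    case 0
    then show ?case by (simp add: Q_def)
  next
    case (Suc J)
    let ?Q = "\<lambda>\<omega>. Q J (\<lambda>i. Y i \<omega>)" and ?d = "\<lambda>\<omega>. d J (\<lambda>i. Y i \<omega>)" and ?h = "\<lambda>\<omega>. h (Y J \<omega>)"
    have Q_int: "integrable P ?Q"
      using Suc QY by (intro square_integrable_imp_integrable[OF QY]) blast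
    have "integrable P (\<lambda>\<omega>. ?Q \<omega> * ?d \<omega>)"
    proof (rule Bochner_Integration.integrable_bound[OF Q_int])
      show "AE \<omega> in P. norm (?Q \<omega> * ?d \<omega>) \<le> norm (?Q \<omega>)"
        using bound by (intro AE_I2) (simp add: abs_mult mult_left_le)
    qed measurable
    then have cross: "integrable P (\<lambda>\<omega>. ?Q \<omega> * ?d \<omega> * ?h \<omega>)" "expectation (\<lambda>\<omega>. ?Q \<omega> * ?d \<omega> * ?h \<omega>) = 0"
      using past_future_product[of "\<lambda>f. Q J f * d J f" J h] Q_meas[of J] d[of J] h_int centred
      by (simp_all add: Q_restrict d_restrict)
    have diag: "integrable P (\<lambda>\<omega>. (?d \<omega>)\<^sup>2 * (?h \<omega>)\<^sup>2)"
      "expectation (\<lambda>\<omega>. (?d \<omega>)\<^sup>2 * (?h \<omega>)\<^sup>2)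
        = expectation (\<lambda>\<omega>. (?d \<omega>)\<^sup>2) * measure_pmf.expectation D (\<lambda>c. (h c)\<^sup>2)"
      using past_future_product[of "\<lambda>f. (d J f)\<^sup>2" J "\<lambda>c. (h c)\<^sup>2"] d[of J] d2[of J] sq
      by (simp_all add: d_restrict)
    have expand: "(Q (Suc J) (\<lambda>i. Y i \<omega>))\<^sup>2 = (?Q \<omega>)\<^sup>2 + 2 * (?Q \<omega> * ?d \<omega> * ?h \<omega>) + (?d \<omega>)\<^sup>2 * (?h \<omega>)\<^sup>2" for \<omega>
      by (simp add: Q_def power2_eq_square algebra_simps)
    show ?case
      unfolding expand using Suc cross diag d2
      by (simp add: algebra_simps)
  qed
  then show "?I J" "?E J" by auto
qed

end

section \<open>The central limit theorem for renewal reward processes\<close>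

lemma sum_indicator_difference:
  fixes h :: "nat \<Rightarrow> real"
  assumes "p \<le> L" "q \<le> L"
  shows "(\<Sum>i<L. h i * ((if i < p then 1 else 0) - (if i < q then 1 else 0))) = (\<Sum>i<p. h i) - (\<Sum>i<q. h i)"
proof -
  have "(\<Sum>i<L. h i * (if i < k then 1 else 0)) = (\<Sum>i<k. h i)" if "k \<le> L" for k
  proof -
    have "(\<Sum>i<k. h i) = (\<Sum>i<L. if i \<in> {..<k} then h i else 0)"
      using that by (subst sum.inter_restrict[symmetric]) (auto intro!: sum.cong)
    also have "\<dots> = (\<Sum>i<L. h i * (if i < k then 1 else 0))" by (rule sum.cong) auto
    finally show ?thesis ..
  qed
  then show ?thesis using assms by (simp only: right_diff_distrib sum_subtractf)
qed

lemma sum_indicator_difference_square: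
  assumes "p \<le> L" "q \<le> L"
  shows "(\<Sum>i<L. ((if i < p then 1 else 0) - (if i < q then 1 else 0) :: real)\<^sup>2) = \<bar>real p - real q\<bar>"
proof -
  have *: "(\<Sum>i<L. ((if i < p then 1 else 0) - (if i < q then 1 else 0) :: real)\<^sup>2) = real q - real p"
    if "p \<le> q" "q \<le> L" for p q
  proof -
    have "(\<Sum>i<L. ((if i < p then 1 else 0) - (if i < q then 1 else 0) :: real)\<^sup>2)
        = (\<Sum>i<L. 1 * ((if i < q then 1 else 0) - (if i < p then 1 else 0) :: real))"
      using that by (intro sum.cong) auto
    also have "\<dots> = real q - real p" using that by (subst sum_indicator_difference) auto
    finally show ?thesis .
  qed
  show ?thesis
  proof (cases "p \<le> q")
    case True
    then show ?thesis using *[of p q] assms by simp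
  next
    case False
    then show ?thesis using *[of q p] assms by (simp add: power2_commute)
  qed
qed

lemma floor_ratio:
  assumes "1 \<le> (m :: real)"
  defines "r \<equiv> \<lambda>n. nat \<lfloor>real n / m\<rfloor>"
  shows "r n \<le> n" "(\<lambda>n. real (r n) / real n) \<longlonglongrightarrow> 1 / m" "filterlim r at_top sequentially"
proof -
  have le: "real (r n) \<le> real n / m" for n
    unfolding r_def using assms(1) by (intro of_nat_floor) simp
  have ge: "real n / m - 1 \<le> real (r n)" for n
    unfolding r_def by linarith
  have "real n / m \<le> real n" using assms(1) by (simp add: divide_le_eq mult_le_cancel_left1)
  then show "r n \<le> n" using le[of n] by linarith
  show "(\<lambda>n. real (r n) / real n) \<longlonglongrightarrow> 1 / m"
  proof (rule tendsto_sandwich)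
    have "(\<lambda>n. 1 / m - 1 / real n) \<longlonglongrightarrow> 1 / m - 0"
      by (intro tendsto_diff tendsto_const lim_1_over_n)
    then show "(\<lambda>n. 1 / m - 1 / real n) \<longlonglongrightarrow> 1 / m" by simp
    show "eventually (\<lambda>n. 1 / m - 1 / real n \<le> real (r n) / real n) sequentially"
      using eventually_gt_at_top[of 0]
    proof eventually_elim
      case (elim n)
      then have "1 / m - 1 / real n = (real n / m - 1) / real n" by (simp add: field_simps)
      also have "\<dots> \<le> real (r n) / real n" using ge by (rule divide_right_mono) simp
      finally show ?case .
    qed
    show "eventually (\<lambda>n. real (r n) / real n \<le> 1 / m) sequentially"
      using eventually_gt_at_top[of 0]
    proof eventually_elim
      case (elim n)
      have "real (r n) / real n \<le> (real n / m) / real n" using le by (rule divide_right_mono) simp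
      also have "\<dots> = 1 / m" using elim by simp
      finally show ?case .
    qed
  qed (rule tendsto_const)
  show "filterlim r at_top sequentially"
    unfolding filterlim_at_top
  proof
    fix k
    show "eventually (\<lambda>n. k \<le> r n) sequentially"
      using eventually_ge_at_top[of "nat \<lceil>(real k + 1) * m\<rceil>"]
    proof eventually_elim
      case (elim n)
      then have "(real k + 1) * m \<le> real n" by linarith
      then have "real k + 1 \<le> real n / m" using assms(1) by (simp add: pos_le_divide_eq)
      then show ?case using ge[of n] by linarith
    qed
  qed
qed

context renewal_reward
begin

definition rate_of_gain :: real where "rate_of_gain = mean_rew / mean_len"

text \<open>The reward of a cycle beyond the long-run rate of gain; it is centred.\<close>

definition excess :: "'c \<Rightarrow> real" where
  "excess c = rew c - rate_of_gain * real (len c)"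

definition excess_variance :: real where
  "excess_variance = measure_pmf.expectation D (\<lambda>c. (excess c)\<^sup>2)"

definition V :: "nat \<Rightarrow> 'w \<Rightarrow> real" where
  "V k \<omega> = (\<Sum>j<k. excess (Y j \<omega>))"

lemma abs_rate_of_gain: "\<bar>rate_of_gain\<bar> \<le> 1"
proof -
  have "\<bar>mean_rew\<bar> \<le> measure_pmf.expectation D (\<lambda>c. \<bar>rew c\<bar>)"
    unfolding mean_rew_def by (rule integral_abs_bound)
  also have "\<dots> \<le> mean_len"
    unfolding mean_len_def by (intro integral_mono integrable_abs rew_integrable len_integrable rew_le)
  finally show ?thesis using mean_len_ge_1 by (simp add: rate_of_gain_def abs_divide)
qed

lemma abs_excess: "\<bar>excess c\<bar> \<le> 2 * real (len c)"
proof -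
  have "\<bar>rate_of_gain * real (len c)\<bar> \<le> real (len c)"
    using mult_right_mono[OF abs_rate_of_gain, of "real (len c)"] by (simp add: abs_mult)
  then show ?thesis using rew_le[of c] unfolding excess_def by linarith
qed

lemma excess_mean: "measure_pmf.expectation D excess = 0"
proof -
  have "measure_pmf.expectation D excess = mean_rew - rate_of_gain * mean_len"
    unfolding excess_def mean_rew_def mean_len_def using rew_integrable len_integrable by simp
  then show ?thesis using mean_len_ge_1 by (simp add: rate_of_gain_def)
qed

lemma V_measurable [measurable]: "V k \<in> borel_measurable P"
  unfolding V_def by simp

lemma stopped_V_measurable [measurable]: "(\<lambda>\<omega>. V (Suc (N n \<omega>)) \<omega>) \<in> borel_measurable P"
  by (rule measurable_compose_countable[where g="\<lambda>\<omega>. Suc (N n \<omega>)"]) measurable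

end

text \<open>Square integrable cycle lengths also control the rewards, which are bounded by the lengths.\<close>

locale renewal_reward_L2 = renewal_reward +
  assumes len_square_integrable: "integrable (measure_pmf D) (\<lambda>c. (real (len c))\<^sup>2)"
begin

lemma excess_square_integrable: "integrable (measure_pmf D) (\<lambda>c. (excess c)\<^sup>2)"
proof (rule Bochner_Integration.integrable_bound)
  show "integrable (measure_pmf D) (\<lambda>c. 4 * (real (len c))\<^sup>2)"
    using len_square_integrable by simp
  show "AE c in measure_pmf D. norm ((excess c)\<^sup>2) \<le> norm (4 * (real (len c))\<^sup>2)"
  proof (rule AE_I2)
    fix c
    have "(excess c)\<^sup>2 \<le> (2 * real (len c))\<^sup>2"
      using abs_excess[of c] unfolding abs_le_square_iff[symmetric] by simp
    then show "norm ((excess c)\<^sup>2) \<le> norm (4 * (real (len c))\<^sup>2)" by (simp add: power_mult_distrib)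
  qed
qed simp

lemma V_second_moment:
  "integrable P (\<lambda>\<omega>. (V k \<omega>)\<^sup>2)" "expectation (\<lambda>\<omega>. (V k \<omega>)\<^sup>2) = real k * excess_variance"
  using transform_second_moment[of "\<lambda>_ _. 1" excess k] excess_square_integrable excess_mean
  by (simp_all add: V_def excess_variance_def prob_space)

text \<open>A cycle index \<open>i\<close> satisfies \<open>i \<le> N n\<close> iff the cycles before \<open>i\<close> last at most \<open>n\<close> in total, which is
  decided before cycle \<open>i\<close>. The difference between the sum stopped after the cycle in progress and the
  sum of the first \<open>k\<close> terms is therefore a predictable transform, with one unit of variance for each
  index between \<open>Suc (N n)\<close> and \<open>k\<close>: Wald's second identity for the difference of two stopping times.\<close>

lemma stopped_V_second_moment:
  assumes k: "k \<le> Suc n"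
  shows "integrable P (\<lambda>\<omega>. (V (Suc (N n \<omega>)) \<omega> - V k \<omega>)\<^sup>2)"
    and "expectation (\<lambda>\<omega>. (V (Suc (N n \<omega>)) \<omega> - V k \<omega>)\<^sup>2)
       = excess_variance * expectation (\<lambda>\<omega>. \<bar>real (Suc (N n \<omega>)) - real k\<bar>)"
proof -
  \<comment> \<open>the predictable factors: index \<open>i\<close> counts once for each of the two stopped sums, with opposite signs\<close>
  let ?d = "\<lambda>i (f :: nat \<Rightarrow> 'b). (if (\<Sum>j<i. real (len (f j))) \<le> real n then 1 else 0)
              - (if i < k then 1 else 0) :: real"
  have d: "?d i (\<lambda>i. Y i \<omega>) = (if i < Suc (N n \<omega>) then 1 else 0) - (if i < k then 1 else 0)" for i \<omega>
  proof -
    have "(\<Sum>j<i. real (len (Y j \<omega>))) \<le> real n \<longleftrightarrow> renewal (\<lambda>j. len (Y j \<omega>)) i \<le> n"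
      by (simp add: renewal_def of_nat_sum[symmetric] del: of_nat_sum)
    also have "\<dots> \<longleftrightarrow> i \<le> N n \<omega>"
      unfolding N_def using len_pos by (intro renewal_le_iff) auto
    finally show ?thesis by (simp add: less_Suc_eq_le)
  qed
  have meas: "?d i \<in> borel_measurable (\<Pi>\<^sub>M i\<in>{..<i}. count_space UNIV)" for i
  proof -
    have [measurable]: "(\<lambda>f. real (len (f j))) \<in> borel_measurable (\<Pi>\<^sub>M i\<in>{..<i}. count_space UNIV)" if "j < i" for j
      by (rule measurable_compose[OF measurable_component_singleton]) (use that in auto)
    have [measurable]: "(\<lambda>f. \<Sum>j<i. real (len (f j))) \<in> borel_measurable (\<Pi>\<^sub>M i\<in>{..<i}. count_space UNIV)"
      by (rule borel_measurable_sum) auto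
    show ?thesis by measurable
  qed
  have local: "?d i f = ?d i g" if "\<And>j. j < i \<Longrightarrow> f j = g j" for i f g
    using that by simp
  have bound: "\<bar>?d i f\<bar> \<le> 1" for i f by simp
  have le: "Suc (N n \<omega>) \<le> Suc n" for \<omega> using N_le by simp
  have sum1: "(\<Sum>i<Suc n. excess (Y i \<omega>) * ?d i (\<lambda>i. Y i \<omega>)) = V (Suc (N n \<omega>)) \<omega> - V k \<omega>" for \<omega>
    unfolding d V_def by (rule sum_indicator_difference[OF le k])
  have sum2: "(\<Sum>i<Suc n. (?d i (\<lambda>i. Y i \<omega>))\<^sup>2) = \<bar>real (Suc (N n \<omega>)) - real k\<bar>" for \<omega>
    unfolding d by (rule sum_indicator_difference_square[OF le k])
  note * = transform_second_moment[of ?d excess "Suc n", OF meas local bound excess_square_integrable excess_mean]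
  show "integrable P (\<lambda>\<omega>. (V (Suc (N n \<omega>)) \<omega> - V k \<omega>)\<^sup>2)"
    using *(1) unfolding sum1 .
  show "expectation (\<lambda>\<omega>. (V (Suc (N n \<omega>)) \<omega> - V k \<omega>)\<^sup>2)
       = excess_variance * expectation (\<lambda>\<omega>. \<bar>real (Suc (N n \<omega>)) - real k\<bar>)"
    using *(2) unfolding sum1 sum2 excess_variance_def[symmetric] .
qed

lemma V_clt:
  assumes pos: "0 < excess_variance"
  shows "weak_conv_m (\<lambda>k. distr P borel (\<lambda>\<omega>. V k \<omega> / sqrt (real k * excess_variance))) std_normal_distribution"
proof -
  have mean: "expectation (\<lambda>\<omega>. excess (Y j \<omega>)) = 0" for j
    by (simp add: Y_expectation excess_mean)
  have "weak_conv_m (\<lambda>k. distr P borel (\<lambda>\<omega>. (\<Sum>j<k. excess (Y j \<omega>)) / sqrt (real k * (sqrt excess_variance)\<^sup>2)))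
      std_normal_distribution"
  proof (rule central_limit_theorem_zero_mean[OF Y_compose_indep mean])
    show "0 < sqrt excess_variance" using pos by simp
    show "integrable P (\<lambda>\<omega>. (excess (Y j \<omega>))\<^sup>2)" for j
      using excess_square_integrable by (simp add: Y_integrable_iff[where h="\<lambda>c. (excess c)\<^sup>2"])
    show "variance (\<lambda>\<omega>. excess (Y j \<omega>)) = (sqrt excess_variance)\<^sup>2" for j
      using pos by (simp add: mean excess_variance_def Y_expectation[where h="\<lambda>c. (excess c)\<^sup>2"])
    show "distr P borel (\<lambda>\<omega>. excess (Y j \<omega>)) = distr (measure_pmf D) borel excess" for j
      by (rule Y_distr)
  qed
  then show ?thesis using pos by (simp add: V_def)
qed

lemma expected_count_error:
  fixes r :: "nat \<Rightarrow> nat"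
  assumes r: "\<And>n. r n \<le> n" and lim: "(\<lambda>n. real (r n) / real n) \<longlonglongrightarrow> 1 / mean_len"
  shows "(\<lambda>n. expectation (\<lambda>\<omega>. \<bar>real (Suc (N n \<omega>)) - real (r n)\<bar>) / real n) \<longlonglongrightarrow> 0"
proof -
  have "(\<lambda>n. expectation (\<lambda>\<omega>. \<bar>real (Suc (N n \<omega>)) - real (r n)\<bar> / real n)) \<longlonglongrightarrow> expectation (\<lambda>_. 0)"
  proof (rule integral_dominated_convergence[where w="\<lambda>_. 2"])
    show "AE \<omega> in P. (\<lambda>n. \<bar>real (Suc (N n \<omega>)) - real (r n)\<bar> / real n) \<longlonglongrightarrow> 0"
      using N_over_n
    proof eventually_elim
      case (elim \<omega>)
      have "(\<lambda>n. \<bar>real (N n \<omega>) / real n + 1 / real n - real (r n) / real n\<bar>) \<longlonglongrightarrow> \<bar>1 / mean_len + 0 - 1 / mean_len\<bar>"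
        by (intro tendsto_rabs tendsto_diff tendsto_add elim lim lim_1_over_n)
      moreover have "\<bar>real (N n \<omega>) / real n + 1 / real n - real (r n) / real n\<bar>
          = \<bar>real (Suc (N n \<omega>)) - real (r n)\<bar> / real n" for n
      proof -
        have "real (N n \<omega>) / real n + 1 / real n - real (r n) / real n = (real (Suc (N n \<omega>)) - real (r n)) / real n"
          by (simp add: add_divide_distrib diff_divide_distrib)
        then show ?thesis by simp
      qed
      ultimately show ?case by simp
    qed
    show "AE \<omega> in P. norm (\<bar>real (Suc (N n \<omega>)) - real (r n)\<bar> / real n) \<le> 2" for n
    proof (rule AE_I2)
      fix \<omega>
      show "norm (\<bar>real (Suc (N n \<omega>)) - real (r n)\<bar> / real n) \<le> 2"
      proof (cases "n = 0")
        case False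
        have "real (N n \<omega>) \<le> real n" "real (r n) \<le> real n" using N_le r by auto
        then have "\<bar>real (Suc (N n \<omega>)) - real (r n)\<bar> \<le> 2 * real n" using False by auto
        then show ?thesis using False by (simp add: divide_le_eq)
      qed simp
    qed
  qed auto
  then show ?thesis by simp
qed

text \<open>The squared cycle lengths have convergent averages, so the square of the current length is
  negligible against the number of cycles, hence against \<open>n\<close>.\<close>

lemma straddling_cycle_negligible:
  "AE \<omega> in P. (\<lambda>n. real (len (Y (N n \<omega>) \<omega>)) / sqrt (real n)) \<longlonglongrightarrow> 0"
  using Y_averages[OF len_square_integrable] N_over_n
proof eventually_elim
  case (elim \<omega>)
  let ?q = "\<lambda>k. (real (len (Y k \<omega>)))\<^sup>2"
  have "(\<lambda>n. ?q (N n \<omega>) / real (N n \<omega>) * (real (N n \<omega>) / real n)) \<longlonglongrightarrow> 0 * (1 / mean_len)"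
    by (intro tendsto_mult elim(2) filterlim_compose[OF averages_imp_terms_vanish[OF elim(1)] N_at_top])
  then have lim: "(\<lambda>n. sqrt (?q (N n \<omega>) / real (N n \<omega>) * (real (N n \<omega>) / real n))) \<longlonglongrightarrow> 0"
    using tendsto_real_sqrt by fastforce
  have "eventually (\<lambda>n. N n \<omega> > 0) sequentially"
    using eventually_gt_at_top[of 0] N_at_top by (rule eventually_compose_filterlim)
  then have "eventually (\<lambda>n. sqrt (?q (N n \<omega>) / real (N n \<omega>) * (real (N n \<omega>) / real n))
      = real (len (Y (N n \<omega>) \<omega>)) / sqrt (real n)) sequentially"
    by eventually_elim (simp add: real_sqrt_divide)
  with lim show ?case by (rule Lim_transform_eventually)
qed

text \<open>Time \<open>n\<close> and the end of the cycle in progress are at most one cycle length apart; so are the reward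
  collected at time \<open>n\<close> and the reward of the complete cycles; and the reward of the cycle in progress is
  bounded by its length. The rate of gain, which weights the first of these distances, is at most \<open>1\<close> in
  modulus.\<close>

lemma remainder_bound:
  "AE \<omega> in P. \<forall>n. \<bar>C n \<omega> - real n * rate_of_gain - V (Suc (N n \<omega>)) \<omega>\<bar> \<le> 3 * real (len (Y (N n \<omega>) \<omega>))"
  using C_close
proof eventually_elim
  case (elim \<omega>)
  show ?case
  proof
    fix n
    let ?k = "N n \<omega>" and ?l = "\<lambda>j. len (Y j \<omega>)"
    let ?R = "\<lambda>k. \<Sum>j<k. rew (Y j \<omega>)" and ?T = "renewal ?l"
    have V: "V (Suc ?k) \<omega> = ?R ?k + rew (Y ?k \<omega>) - rate_of_gain * real (?T (Suc ?k))"
      by (simp add: V_def excess_def sum_subtractf sum_distrib_left renewal_def algebra_simps)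
    have T: "?T ?k \<le> n" "n < ?T (Suc ?k)"
      unfolding N_def using cycle_of_bounds[of ?l n] len_pos by auto
    then have "\<bar>real (?T (Suc ?k)) - real n\<bar> \<le> real (?l ?k)" by simp
    then have "\<bar>rate_of_gain\<bar> * \<bar>real (?T (Suc ?k)) - real n\<bar> \<le> 1 * real (?l ?k)"
      by (intro mult_mono abs_rate_of_gain) auto
    then have g: "\<bar>rate_of_gain * (real (?T (Suc ?k)) - real n)\<bar> \<le> real (?l ?k)"
      by (simp add: abs_mult)
    have c: "\<bar>C n \<omega> - ?R ?k\<bar> \<le> real (?l ?k)" using elim by (simp add: N_def)
    have "C n \<omega> - real n * rate_of_gain - V (Suc ?k) \<omega>
        = (C n \<omega> - ?R ?k) - rew (Y ?k \<omega>) + rate_of_gain * (real (?T (Suc ?k)) - real n)"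
      by (simp only: V) (simp add: algebra_simps)
    then show "\<bar>C n \<omega> - real n * rate_of_gain - V (Suc ?k) \<omega>\<bar> \<le> 3 * real (?l ?k)"
      using g c rew_le[of "Y ?k \<omega>"] by linarith
  qed
qed

text \<open>Up to time \<open>n\<close> there are \<open>N n\<close> complete cycles, close to the deterministic number \<open>r n \<approx> n / mean_len\<close>.
  For the latter the classical theorem applies. Replacing it by the random number costs, in mean
  square, the variance times \<open>expectation \<bar>Suc (N n) - r n\<bar>\<close>, which is \<open>o(n)\<close>. What remains are the cycle in
  progress and the ratio of the two normalizations.\<close>

theorem renewal_reward_clt:
  assumes pos: "0 < excess_variance"
  shows "weak_conv_m (\<lambda>n. distr P borel (\<lambda>\<omega>. 1 / sqrt (real n * (excess_variance / mean_len)) *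
           (C n \<omega> - real n * rate_of_gain))) std_normal_distribution"
proof -
  have m: "0 < mean_len" using mean_len_ge_1 by simp
  define r where "r n = nat \<lfloor>real n / mean_len\<rfloor>" for n :: nat
  have r: "\<And>n. r n \<le> n" "(\<lambda>n. real (r n) / real n) \<longlonglongrightarrow> 1 / mean_len" "filterlim r at_top sequentially"
    unfolding r_def by (rule floor_ratio[OF mean_len_ge_1])+
  define s where "s n = sqrt (real n * (excess_variance / mean_len))" for n
  define A where "A n \<omega> = V (r n) \<omega> / sqrt (real (r n) * excess_variance)" for n \<omega>
  define B where "B n \<omega> = 1 / s n * (C n \<omega> - real n * rate_of_gain)" for n \<omega>
  \<comment> \<open>ratio of the normalizations for \<open>r n\<close> cycles and for \<open>n\<close> units of time\<close>
  define c where "c n = sqrt (real (r n) * excess_variance) / s n" for n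
  have [measurable]: "A n \<in> borel_measurable P" "B n \<in> borel_measurable P" for n
    unfolding A_def B_def by simp_all
  have "weak_conv_m (\<lambda>n. distr P borel (A n)) std_normal_distribution"
    unfolding A_def by (rule weak_conv_m_subseq[OF V_clt[OF pos] r(3)])
  moreover have "vanishes_in_prob (\<lambda>n \<omega>. B n \<omega> - A n \<omega>)"
  proof -
    have "vanishes_in_prob (\<lambda>n \<omega>. (c n - 1) * A n \<omega>)"
    proof (rule vanishes_in_prob_L2)
      have A2: "integrable P (\<lambda>\<omega>. (A n \<omega>)\<^sup>2)" "expectation (\<lambda>\<omega>. (A n \<omega>)\<^sup>2) \<le> 1" for n
        unfolding A_def power_divide using V_second_moment[of "r n"] pos
        by (simp_all add: divide_le_eq_1)
      show "integrable P (\<lambda>\<omega>. ((c n - 1) * A n \<omega>)\<^sup>2)" for n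
        using A2(1) by (simp add: power_mult_distrib)
      have "(\<lambda>n. sqrt (real (r n) / real n * mean_len)) \<longlonglongrightarrow> sqrt (1 / mean_len * mean_len)"
        by (intro tendsto_intros r(2))
      moreover have "sqrt (real (r n) / real n * mean_len) = c n" for n
        using pos by (simp add: c_def s_def real_sqrt_divide[symmetric])
      ultimately have "c \<longlonglongrightarrow> 1" using m by simp
      then have "(\<lambda>n. (c n - 1)\<^sup>2) \<longlonglongrightarrow> (1 - 1)\<^sup>2" by (intro tendsto_intros)
      then have lim: "(\<lambda>n. (c n - 1)\<^sup>2) \<longlonglongrightarrow> 0" by simp
      show "(\<lambda>n. expectation (\<lambda>\<omega>. ((c n - 1) * A n \<omega>)\<^sup>2)) \<longlonglongrightarrow> 0"
      proof (rule tendsto_sandwich[OF always_eventually always_eventually tendsto_const lim]; intro allI)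
        fix n
        show "expectation (\<lambda>\<omega>. ((c n - 1) * A n \<omega>)\<^sup>2) \<le> (c n - 1)\<^sup>2"
          using A2(2)[of n] by (simp add: power_mult_distrib mult_left_le)
      qed simp
    qed simp
    moreover have "vanishes_in_prob (\<lambda>n \<omega>. (V (Suc (N n \<omega>)) \<omega> - V (r n) \<omega>) / s n)"
    proof (rule vanishes_in_prob_L2)
      have rS: "r n \<le> Suc n" for n using r(1)[of n] by simp
      show "integrable P (\<lambda>\<omega>. ((V (Suc (N n \<omega>)) \<omega> - V (r n) \<omega>) / s n)\<^sup>2)" for n
        unfolding power_divide using stopped_V_second_moment(1)[OF rS] by simp
      have "expectation (\<lambda>\<omega>. ((V (Suc (N n \<omega>)) \<omega> - V (r n) \<omega>) / s n)\<^sup>2)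
          = mean_len * (expectation (\<lambda>\<omega>. \<bar>real (Suc (N n \<omega>)) - real (r n)\<bar>) / real n)" for n
        unfolding power_divide using stopped_V_second_moment(2)[OF rS] pos m by (simp add: s_def)
      moreover have "(\<lambda>n. mean_len * (expectation (\<lambda>\<omega>. \<bar>real (Suc (N n \<omega>)) - real (r n)\<bar>) / real n))
          \<longlonglongrightarrow> mean_len * 0"
        by (intro tendsto_mult tendsto_const expected_count_error r)
      ultimately show "(\<lambda>n. expectation (\<lambda>\<omega>. ((V (Suc (N n \<omega>)) \<omega> - V (r n) \<omega>) / s n)\<^sup>2)) \<longlonglongrightarrow> 0"
        by simp
    qed simp
    moreover have "vanishes_in_prob (\<lambda>n \<omega>. (C n \<omega> - real n * rate_of_gain - V (Suc (N n \<omega>)) \<omega>) / s n)"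
    proof (rule vanishes_in_prob_AE)
      let ?K = "3 * sqrt (mean_len / excess_variance)"
      show "AE \<omega> in P. (\<lambda>n. (C n \<omega> - real n * rate_of_gain - V (Suc (N n \<omega>)) \<omega>) / s n) \<longlonglongrightarrow> 0"
        using straddling_cycle_negligible remainder_bound
      proof eventually_elim
        case (elim \<omega>)
        have "(\<lambda>n. ?K * (real (len (Y (N n \<omega>) \<omega>)) / sqrt (real n))) \<longlonglongrightarrow> ?K * 0"
          by (intro tendsto_mult tendsto_const elim(1))
        then have "(\<lambda>n. ?K * (real (len (Y (N n \<omega>) \<omega>)) / sqrt (real n))) \<longlonglongrightarrow> 0" by simp
        then show ?case
        proof (rule Lim_null_comparison[rotated], intro always_eventually allI)
          fix n
          have "\<bar>(C n \<omega> - real n * rate_of_gain - V (Suc (N n \<omega>)) \<omega>) / s n\<bar>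
              \<le> 3 * real (len (Y (N n \<omega>) \<omega>)) / s n"
            using elim(2) pos m by (simp add: abs_divide s_def divide_right_mono)
          also have "\<dots> = ?K * (real (len (Y (N n \<omega>) \<omega>)) / sqrt (real n))"
            using pos m by (simp add: s_def real_sqrt_mult real_sqrt_divide mult.commute)
          finally show "norm ((C n \<omega> - real n * rate_of_gain - V (Suc (N n \<omega>)) \<omega>) / s n)
              \<le> ?K * (real (len (Y (N n \<omega>) \<omega>)) / sqrt (real n))" by simp
        qed
      qed
    qed simp
    ultimately have "vanishes_in_prob (\<lambda>n \<omega>. (c n - 1) * A n \<omega>
        + ((V (Suc (N n \<omega>)) \<omega> - V (r n) \<omega>) / s n
        + (C n \<omega> - real n * rate_of_gain - V (Suc (N n \<omega>)) \<omega>) / s n))"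
      by (intro vanishes_in_prob_add)
    moreover have "(c n - 1) * A n \<omega> + ((V (Suc (N n \<omega>)) \<omega> - V (r n) \<omega>) / s n
        + (C n \<omega> - real n * rate_of_gain - V (Suc (N n \<omega>)) \<omega>) / s n) = B n \<omega> - A n \<omega>" for n \<omega>
    proof -
      \<comment> \<open>if \<open>r n = 0\<close>, then \<open>A n\<close> is a quotient by zero, but the sum \<open>V (r n)\<close> is empty as well\<close>
      have "c n * A n \<omega> = V (r n) \<omega> / s n"
        using pos by (cases "r n = 0") (simp_all add: c_def A_def V_def)
      then show ?thesis by (simp add: B_def left_diff_distrib diff_divide_distrib)
    qed
    ultimately show ?thesis by simp
  qed
  ultimately have "weak_conv_m (\<lambda>n. distr P borel (B n)) std_normal_distribution"
    by (rule slutsky[OF _ _ _ real_dist_normal_dist, rotated 2]) simp_all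
  then show ?thesis by (simp add: B_def[abs_def] s_def)
qed

end

section \<open>Occupation sums and change times along a trajectory\<close>

lemma abs_alternating: "\<bar>fst (alternating y n)\<bar> = 1"
  by (simp add: alternating_def Let_def)

lemma sum_lessThan_add:
  fixes f :: "nat \<Rightarrow> 'b::comm_monoid_add"
  shows "(\<Sum>i<m + n. f i) = (\<Sum>i<m. f i) + (\<Sum>i<n. f (m + i))"
  by (induction n) (simp_all add: add.assoc)

lemma sum_alternating:
  assumes y: "pos_cycles y"
  shows "(\<Sum>i<start y k. fst (alternating y i)) = (\<Sum>j<k. real (fst (y j)) - real (snd (y j)))"
proof (induction k)
  case (Suc k)
  have "(\<Sum>i<start y (Suc k). fst (alternating y i)) = (\<Sum>i<start y k. fst (alternating y i))
      + (\<Sum>i<fst (y k). fst (alternating y (start y k + i)))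
      + (\<Sum>i<snd (y k). fst (alternating y (start y k + fst (y k) + i)))"
    by (simp add: cyc_len_def add.assoc[symmetric] sum_lessThan_add)
  also have "(\<Sum>i<fst (y k). fst (alternating y (start y k + i))) = real (fst (y k))"
    using alternating_up[OF y, of _ k] by simp
  also have "(\<Sum>i<snd (y k). fst (alternating y (start y k + fst (y k) + i))) = - real (snd (y k))"
    using alternating_down[OF y, of _ k] by simp
  finally show ?case using Suc by simp
qed simp

text \<open>Complete cycles contribute exactly their gain, and each time of the cycle in progress, the
  present one included, contributes \<open>\<plusminus> 1\<close>.\<close>

lemma occupation_close:
  assumes y: "pos_cycles y"
  defines "k \<equiv> \<lambda>n. cycle_of (\<lambda>j. cyc_len (y j)) n"
  shows "\<bar>(\<Sum>i\<le>n. fst (alternating y i)) - (\<Sum>j<k n. real (fst (y j)) - real (snd (y j)))\<bar>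
       \<le> real (cyc_len (y (k n)))"
proof -
  let ?s = "start y (k n)"
  have b: "?s \<le> n" "n < start y (Suc (k n))"
    unfolding k_def using cycle_of_bounds[of "\<lambda>j. cyc_len (y j)" n] pos_cyc_len[OF y] by auto
  then have n: "{..n} = {..<?s + (Suc n - ?s)}" by auto
  have "(\<Sum>i\<le>n. fst (alternating y i))
      = (\<Sum>j<k n. real (fst (y j)) - real (snd (y j))) + (\<Sum>i<Suc n - ?s. fst (alternating y (?s + i)))"
    unfolding n sum_lessThan_add sum_alternating[OF y] ..
  moreover have "\<bar>\<Sum>i<Suc n - ?s. fst (alternating y (?s + i))\<bar> \<le> (\<Sum>i<Suc n - ?s. \<bar>fst (alternating y (?s + i))\<bar>)"
    by (rule sum_abs)
  moreover have "(\<Sum>i<Suc n - ?s. \<bar>fst (alternating y (?s + i))\<bar>) \<le> real (cyc_len (y (k n)))"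
    using b by (simp add: abs_alternating)
  ultimately show ?thesis by linarith
qed

text \<open>An infimum of a set of times, rewritten as a least number so that its measurability can be shown.\<close>

lemma Inf_enat_Collect:
  "Inf {enat i | i. Q i} = (if \<exists>i. Q i then enat (LEAST i. Q i) else \<infinity>)"
proof (cases "\<exists>i. Q i")
  case True
  have "Inf {enat i | i. Q i} = enat (LEAST i. Q i)"
  proof (rule antisym)
    show "Inf {enat i | i. Q i} \<le> enat (LEAST i. Q i)"
      using LeastI_ex[OF True] by (intro Inf_lower) auto
    show "enat (LEAST i. Q i) \<le> Inf {enat i | i. Q i}"
      by (rule Inf_greatest) (auto intro: Least_le)
  qed
  then show ?thesis using True by simp
qed (simp add: top_enat_def)

lemma change_time_Suc_eq:
  assumes s: "change_time X k \<omega> = enat s" and "s \<le> t" "X t \<omega> \<noteq> X s \<omega>"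
    and const: "\<And>i. s \<le> i \<Longrightarrow> i < t \<Longrightarrow> X i \<omega> = X s \<omega>"
  shows "change_time X (Suc k) \<omega> = enat t"
proof -
  have "(LEAST i. s \<le> i \<and> X i \<omega> \<noteq> X s \<omega>) = t"
    using assms by (intro Least_equality) (auto simp: not_less[symmetric])
  moreover have "\<exists>i. s \<le> i \<and> X i \<omega> \<noteq> X s \<omega>" using assms(2,3) by blast
  ultimately show ?thesis by (simp add: s Inf_enat_Collect)
qed

lemma change_times_alternating:
  assumes y: "pos_cycles y" and X: "\<And>n. X n \<omega> = fst (alternating y n)"
  shows "change_time X 1 \<omega> = enat (fst (y 0))" "change_time X 2 \<omega> = enat (cyc_len (y 0))"
proof -
  have pos: "0 < fst (y 0)" "0 < snd (y 0)" using y by (auto simp: pos_cycles_def)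
  have up: "X i \<omega> = 1" if "i < fst (y 0)" for i
    using alternating_up[OF y, of i 0] that by (simp add: X)
  have down: "X i \<omega> = - 1" if "fst (y 0) \<le> i" "i < cyc_len (y 0)" for i
    using alternating_down[OF y, of "i - fst (y 0)" 0] that by (simp add: X cyc_len_def)
  have again: "X (cyc_len (y 0)) \<omega> = 1"
    using alternating_start[OF y, of 1] by (simp add: X)
  have 1: "change_time X (Suc 0) \<omega> = enat (fst (y 0))"
    by (rule change_time_Suc_eq[of X 0 \<omega> 0]) (use up down pos in \<open>auto simp: cyc_len_def zero_enat_def\<close>)
  have 2: "change_time X (Suc (Suc 0)) \<omega> = enat (cyc_len (y 0))"
    using 1 by (rule change_time_Suc_eq) (use down again pos in \<open>auto simp: cyc_len_def\<close>)
  from 1 2 show "change_time X 1 \<omega> = enat (fst (y 0))" "change_time X 2 \<omega> = enat (cyc_len (y 0))"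
    by (simp_all add: numeral_2_eq_2)
qed

section \<open>The chain as a renewal reward process\<close>

context sign_chain
begin

text \<open>The sum of the signs over a cycle.\<close>

definition gain :: "nat \<times> nat \<Rightarrow> real" where
  "gain p = real (fst p) - real (snd p)"

lemma psum_measurable [measurable]: "psum X n \<in> borel_measurable P"
proof -
  have [measurable]: "X k \<in> borel_measurable P" for k by (rule X_measurable)
  show ?thesis unfolding psum_def by measurable
qed

lemma pos_Y: "pos_cycles (\<lambda>j. Y j \<omega>)"
  unfolding Y_def by (rule pos_cycles_cyc)

lemma cycle_marginals:
  "map_pmf fst (cycle_pmf \<alpha>) = sojourn_pmf \<alpha> 2" "map_pmf snd (cycle_pmf \<alpha>) = sojourn_pmf \<alpha> 1"
  by (simp_all add: cycle_pmf_def map_fst_pair_pmf map_snd_pair_pmf)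

lemma up_integrable: "integrable (measure_pmf (cycle_pmf \<alpha>)) (\<lambda>p. real (fst p))"
  and up_mean: "measure_pmf.expectation (cycle_pmf \<alpha>) (\<lambda>p. real (fst p)) = Theta \<alpha> 2"
  and down_integrable: "integrable (measure_pmf (cycle_pmf \<alpha>)) (\<lambda>p. real (snd p))"
  and down_mean: "measure_pmf.expectation (cycle_pmf \<alpha>) (\<lambda>p. real (snd p)) = Theta \<alpha> 1"
proof -
  show "integrable (measure_pmf (cycle_pmf \<alpha>)) (\<lambda>p. real (fst p))"
    "integrable (measure_pmf (cycle_pmf \<alpha>)) (\<lambda>p. real (snd p))"
    using up.sojourn_integrable down.sojourn_integrable unfolding cycle_marginals[symmetric] by simp_all
  show "measure_pmf.expectation (cycle_pmf \<alpha>) (\<lambda>p. real (fst p)) = Theta \<alpha> 2"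
    "measure_pmf.expectation (cycle_pmf \<alpha>) (\<lambda>p. real (snd p)) = Theta \<alpha> 1"
    using up.sojourn_mean down.sojourn_mean unfolding cycle_marginals[symmetric] by simp_all
qed

sublocale reward: renewal_reward P Y "cycle_pmf \<alpha>" cyc_len gain "psum X"
proof
  show "indep_vars (\<lambda>_. count_space UNIV) Y UNIV" by (rule Y_indep)
  show "distr P (count_space UNIV) (Y j) = measure_pmf (cycle_pmf \<alpha>)" for j by (rule Y_law)
  show "0 < cyc_len (Y j \<omega>)" for j \<omega> using pos_cyc_len[OF pos_Y] .
  show "integrable (measure_pmf (cycle_pmf \<alpha>)) (\<lambda>c. real (cyc_len c))"
    unfolding cyc_len_def using up_integrable down_integrable by simp
  show "\<bar>gain c\<bar> \<le> real (cyc_len c)" for c by (simp add: gain_def cyc_len_def)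
  show "psum X n \<in> borel_measurable P" for n by (rule psum_measurable)
  show "AE \<omega> in P. \<forall>n. \<bar>psum X n \<omega> - (\<Sum>j<cycle_of (\<lambda>j. cyc_len (Y j \<omega>)) n. gain (Y j \<omega>))\<bar>
      \<le> real (cyc_len (Y (cycle_of (\<lambda>j. cyc_len (Y j \<omega>)) n) \<omega>))"
    using trajectory
  proof eventually_elim
    case (elim \<omega>)
    then show ?case
      using occupation_close[OF pos_Y, of \<omega>] by (simp add: psum_def gain_def)
  qed
qed

lemma mean_len_eq: "reward.mean_len = Theta \<alpha> 1 + Theta \<alpha> 2"
  unfolding reward.mean_len_def cyc_len_def
  using up_integrable down_integrable by (simp add: up_mean down_mean)

lemma mean_rew_eq: "reward.mean_rew = Theta \<alpha> 2 - Theta \<alpha> 1"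
  unfolding reward.mean_rew_def gain_def
  using up_integrable down_integrable by (simp add: up_mean down_mean)

lemma gain_rate_eq: "reward.rate_of_gain = (Theta \<alpha> 2 - Theta \<alpha> 1) / (Theta \<alpha> 1 + Theta \<alpha> 2)"
  by (simp add: reward.rate_of_gain_def mean_len_eq mean_rew_eq)

lemma abs_psum_le:
  assumes "\<omega> \<in> space P"
  shows "\<bar>psum X n \<omega> / real n\<bar> \<le> 2"
proof -
  have "\<bar>X k \<omega>\<bar> = 1" for k
    using measurable_space[OF Z_measurable, OF assms, of k] by (auto simp: states_def a_def)
  then have "\<bar>psum X n \<omega>\<bar> \<le> real (Suc n)"
    unfolding psum_def using sum_abs[of "\<lambda>k. X k \<omega>" "{..n}"] by simp
  then show ?thesis by (cases "n = 0") (simp_all add: abs_divide divide_le_eq)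
qed

lemma psum_integrable: "integrable P (\<lambda>\<omega>. psum X n \<omega> / real n)"
  by (rule integrable_const_bound[where B=2]) (use abs_psum_le in auto)

lemma psum_LLN: "AE \<omega> in P. (\<lambda>n. psum X n \<omega> / real n)
    \<longlonglongrightarrow> (Theta \<alpha> 2 - Theta \<alpha> 1) / (Theta \<alpha> 1 + Theta \<alpha> 2)"
  using reward.renewal_reward_law by (simp add: mean_len_eq mean_rew_eq)

lemma psum_L1: "(\<lambda>n. LINT \<omega>|P. \<bar>psum X n \<omega> / real n
    - (Theta \<alpha> 2 - Theta \<alpha> 1) / (Theta \<alpha> 1 + Theta \<alpha> 2)\<bar>) \<longlonglongrightarrow> 0"
proof -
  let ?\<mu> = "(Theta \<alpha> 2 - Theta \<alpha> 1) / (Theta \<alpha> 1 + Theta \<alpha> 2)"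
  have "(\<lambda>n. LINT \<omega>|P. \<bar>psum X n \<omega> / real n - ?\<mu>\<bar>) \<longlonglongrightarrow> (LINT \<omega>|P. 0)"
  proof (rule integral_dominated_convergence[where w="\<lambda>_. 2 + \<bar>?\<mu>\<bar>"])
    show "AE \<omega> in P. (\<lambda>n. \<bar>psum X n \<omega> / real n - ?\<mu>\<bar>) \<longlonglongrightarrow> 0"
      using psum_LLN
    proof eventually_elim
      case (elim \<omega>)
      then show ?case using tendsto_rabs_zero[OF LIM_zero[OF elim]] by simp
    qed
    show "AE \<omega> in P. norm \<bar>psum X n \<omega> / real n - ?\<mu>\<bar> \<le> 2 + \<bar>?\<mu>\<bar>" for n
    proof (rule AE_I2)
      fix \<omega> assume "\<omega> \<in> space P"
      then show "norm \<bar>psum X n \<omega> / real n - ?\<mu>\<bar> \<le> 2 + \<bar>?\<mu>\<bar>"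
        using abs_psum_le[of \<omega> n] abs_triangle_ineq4[of "psum X n \<omega> / real n" ?\<mu>] by simp
    qed
  qed auto
  then show ?thesis by simp
qed

text \<open>The integrand of \<open>Upsilon\<close> can be replaced by an almost everywhere equal one only if it is
  measurable, also where the change times are infinite.\<close>

lemma change_time_measurable: "(\<lambda>\<omega>. change_time X k \<omega>) \<in> measurable P (count_space UNIV)"
proof (induction k)
  case (Suc k)
  have "(\<lambda>\<omega>. the_enat (change_time X k \<omega>)) \<in> measurable P (count_space UNIV)"
    by (rule measurable_compose[OF Suc]) simp
  then have current: "(\<lambda>\<omega>. X (the_enat (change_time X k \<omega>)) \<omega>) \<in> borel_measurable P"
    by (rule measurable_compose_countable[OF X_measurable])
  define Q where "Q i \<omega> \<longleftrightarrow> change_time X k \<omega> \<le> enat i \<and> X i \<omega> \<noteq> X (the_enat (change_time X k \<omega>)) \<omega>"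
    for i \<omega>
  have reached: "Measurable.pred P (\<lambda>\<omega>. change_time X k \<omega> \<le> enat i)" for i
    by (rule measurable_compose[OF Suc]) simp
  have [measurable]: "Measurable.pred P (Q i)" for i
    unfolding Q_def
  proof (intro pred_intros_logic reached)
    show "Measurable.pred P (\<lambda>\<omega>. X i \<omega> = X (the_enat (change_time X k \<omega>)) \<omega>)"
      unfolding pred_def by (rule borel_measurable_eq[OF X_measurable current])
  qed
  have [measurable]: "(\<lambda>\<omega>. enat (LEAST i. Q i \<omega>)) \<in> measurable P (count_space UNIV)"
    by (rule measurable_compose[OF measurable_Least]) simp_all
  have "(\<lambda>\<omega>. if \<exists>i. Q i \<omega> then enat (LEAST i. Q i \<omega>) else \<infinity>) \<in> measurable P (count_space UNIV)"
    by measurable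
  also have "(\<lambda>\<omega>. if \<exists>i. Q i \<omega> then enat (LEAST i. Q i \<omega>) else \<infinity>) = (\<lambda>\<omega>. change_time X (Suc k) \<omega>)"
    unfolding change_time.simps(2) Q_def Inf_enat_Collect ..
  finally show ?case .
qed simp

text \<open>A cycle with \<open>T\<^sub>1 = fst p\<close> and \<open>T\<^sub>2 = cyc_len p\<close> has the gain \<open>2 * T\<^sub>1 - T\<^sub>2\<close>, and
  \<open>1 + rate_of_gain = 2 * Theta \<alpha> 2 / (Theta \<alpha> 1 + Theta \<alpha> 2)\<close>.\<close>

lemma excess_eq: "(reward.excess p)\<^sup>2
    = 4 * (real (fst p) - Theta \<alpha> 2 * real (cyc_len p) / (Theta \<alpha> 1 + Theta \<alpha> 2))\<^sup>2"
proof -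
  have "Theta \<alpha> 1 + Theta \<alpha> 2 > 0" using up.Theta_ge_1 down.Theta_ge_1 by linarith
  then have "reward.excess p = 2 * (real (fst p) - Theta \<alpha> 2 * real (cyc_len p) / (Theta \<alpha> 1 + Theta \<alpha> 2))"
    by (simp add: reward.excess_def gain_rate_eq gain_def cyc_len_def field_simps)
  then show ?thesis by (simp only: power_mult_distrib) simp
qed

lemma Upsilon_eq: "Upsilon \<alpha> P X = reward.excess_variance / reward.mean_len"
proof -
  let ?f = "\<lambda>\<omega>. (real (the_enat (change_time X 1 \<omega>))
        - Theta \<alpha> 2 * real (the_enat (change_time X 2 \<omega>)) / (Theta \<alpha> 1 + Theta \<alpha> 2))\<^sup>2"
  have [measurable]: "(\<lambda>\<omega>. real (the_enat (change_time X k \<omega>))) \<in> borel_measurable P" for k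
    by (rule measurable_compose[OF change_time_measurable]) simp
  have "(LINT \<omega>|P. ?f \<omega>) = expectation (\<lambda>\<omega>. (reward.excess (Y 0 \<omega>))\<^sup>2 / 4)"
  proof (rule integral_cong_AE)
    show "AE \<omega> in P. ?f \<omega> = (reward.excess (Y 0 \<omega>))\<^sup>2 / 4"
      using trajectory
    proof eventually_elim
      case (elim \<omega>)
      then show ?case
        using change_times_alternating[OF pos_Y, of X \<omega> \<omega>] by (simp add: excess_eq)
    qed
  qed measurable
  also have "\<dots> = reward.excess_variance / 4"
    using reward.Y_expectation[where h="\<lambda>c. (reward.excess c)\<^sup>2" and j=0]
    by (simp add: reward.excess_variance_def)
  finally show ?thesis by (simp add: Upsilon_def mean_len_eq)
qed

end

locale sign_chain_L2 = sign_chain +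
  assumes summ2: "\<And>i. i \<in> {1, 2} \<Longrightarrow> summable (\<lambda>k. real (Suc k) * surv \<alpha> i (Suc k))"
begin

sublocale reward: renewal_reward_L2 P Y "cycle_pmf \<alpha>" cyc_len gain "psum X"
proof
  have "integrable (measure_pmf (cycle_pmf \<alpha>)) (\<lambda>p. (real (fst p))\<^sup>2)"
    "integrable (measure_pmf (cycle_pmf \<alpha>)) (\<lambda>p. (real (snd p))\<^sup>2)"
    using up.sojourn_square_integrable[OF summ2] down.sojourn_square_integrable[OF summ2]
    unfolding cycle_marginals[symmetric] by simp_all
  then have int: "integrable (measure_pmf (cycle_pmf \<alpha>)) (\<lambda>p. 2 * (real (fst p))\<^sup>2 + 2 * (real (snd p))\<^sup>2)"
    by simp
  show "integrable (measure_pmf (cycle_pmf \<alpha>)) (\<lambda>c. (real (cyc_len c))\<^sup>2)"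
  proof (rule Bochner_Integration.integrable_bound[OF int])
    show "AE p in measure_pmf (cycle_pmf \<alpha>). norm ((real (cyc_len p))\<^sup>2)
        \<le> norm (2 * (real (fst p))\<^sup>2 + 2 * (real (snd p))\<^sup>2)"
    proof (rule AE_I2)
      fix p
      show "norm ((real (cyc_len p))\<^sup>2) \<le> norm (2 * (real (fst p))\<^sup>2 + 2 * (real (snd p))\<^sup>2)"
        using sum_squares_bound[of "real (fst p)" "real (snd p)"]
        by (simp add: cyc_len_def power2_sum)
    qed
  qed simp
qed

text \<open>The cycles \<open>(1, 1)\<close> and \<open>(2, 1)\<close> both have positive probability. If the excess vanished almost surely,
  the first would force the rate of gain to be \<open>0\<close> and the second would force it to be \<open>1/3\<close>.\<close>

lemma excess_variance_pos: "0 < reward.excess_variance"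
proof (rule ccontr)
  assume "\<not> 0 < reward.excess_variance"
  moreover have "0 \<le> reward.excess_variance"
    unfolding reward.excess_variance_def by simp
  ultimately have "reward.excess_variance = 0" by simp
  then have "AE p in measure_pmf (cycle_pmf \<alpha>). (reward.excess p)\<^sup>2 = 0"
    unfolding reward.excess_variance_def
    using integral_nonneg_eq_0_iff_AE[OF reward.excess_square_integrable] by simp
  then have zero: "reward.excess p = 0" if "p \<in> set_pmf (cycle_pmf \<alpha>)" for p
    using that by (simp add: AE_measure_pmf_iff)
  have "(1, 1) \<in> set_pmf (cycle_pmf \<alpha>)" "(2, 1) \<in> set_pmf (cycle_pmf \<alpha>)"
    using up.sojourn_support down.sojourn_support by (simp_all add: cycle_pmf_def)
  then have "reward.excess (1, 1) = 0" "reward.excess (2, 1) = 0"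
    by (auto intro: zero)
  then show False by (simp add: reward.excess_def gain_def cyc_len_def)
qed

lemma psum_CLT: "weak_conv_m
    (\<lambda>n. distr P borel (\<lambda>\<omega>. 1 / sqrt (real n * Upsilon \<alpha> P X) *
       (psum X n \<omega> - real n * ((Theta \<alpha> 2 - Theta \<alpha> 1) / (Theta \<alpha> 1 + Theta \<alpha> 2)))))
    std_normal_distribution"
  using reward.renewal_reward_clt[OF excess_variance_pos]
  by (simp only: Upsilon_eq gain_rate_eq)

end

theorem proposition4p14:
  fixes P :: "'w measure"
    and \<alpha> :: "nat \<Rightarrow> nat \<Rightarrow> real"
    and X :: "nat \<Rightarrow> 'w \<Rightarrow> real"
    and M :: "nat \<Rightarrow> 'w \<Rightarrow> nat"
  assumes "\<And>i n. i \<in> {1, 2} \<Longrightarrow> n \<ge> 1 \<Longrightarrow> 0 < \<alpha> i n \<and> \<alpha> i n < 1"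
    and "markov_chain P states (trans_prob \<alpha>) (\<lambda>n \<omega>. (X n \<omega>, M n \<omega>))"
    and "AE \<omega> in P. X 0 \<omega> = 1 \<and> M 0 \<omega> = 1"
    and "\<And>i. i \<in> {1, 2} \<Longrightarrow> summable (\<lambda>n. surv \<alpha> i (Suc n))"
  shows "((AE \<omega> in P. (\<lambda>n. psum X n \<omega> / real n)
            \<longlonglongrightarrow> (Theta \<alpha> 2 - Theta \<alpha> 1) / (Theta \<alpha> 1 + Theta \<alpha> 2)) \<and>
          (\<forall>n. integrable P (\<lambda>\<omega>. psum X n \<omega> / real n)) \<and>
          (\<lambda>n. LINT \<omega>|P. \<bar>psum X n \<omega> / real n
              - (Theta \<alpha> 2 - Theta \<alpha> 1) / (Theta \<alpha> 1 + Theta \<alpha> 2)\<bar>) \<longlonglongrightarrow> 0) \<and>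
         ((\<forall>i\<in>{1, 2}. summable (\<lambda>k. real (Suc k) * surv \<alpha> i (Suc k))) \<longrightarrow>
          weak_conv_m
            (\<lambda>n. distr P borel (\<lambda>\<omega>. 1 / sqrt (real n * Upsilon \<alpha> P X) *
              (psum X n \<omega> - real n * ((Theta \<alpha> 2 - Theta \<alpha> 1) / (Theta \<alpha> 1 + Theta \<alpha> 2)))))
            std_normal_distribution)"
proof -
  have "prob_space P" using assms(2) by (simp add: markov_chain_def)
  then interpret sign_chain P \<alpha> X M
    using assms by (intro sign_chain.intro sign_chain_axioms.intro) auto
  show ?thesis
  proof (intro conjI impI allI psum_LLN psum_integrable psum_L1)
    assume "\<forall>i\<in>{1, 2}. summable (\<lambda>k. real (Suc k) * surv \<alpha> i (Suc k))"
    then interpret L2: sign_chain_L2 P \<alpha> X M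
      by unfold_locales auto
    show "weak_conv_m
            (\<lambda>n. distr P borel (\<lambda>\<omega>. 1 / sqrt (real n * Upsilon \<alpha> P X) *
              (psum X n \<omega> - real n * ((Theta \<alpha> 2 - Theta \<alpha> 1) / (Theta \<alpha> 1 + Theta \<alpha> 2)))))
            std_normal_distribution"
      by (rule L2.psum_CLT)
  qed
qed

end
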